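(* Let $f$ be an inner function with $D=\sup_{z\in\mathbb D}D_h(f)(z)<1$. Then $M^{1-D}\big(f^{-1}(\{\alpha\})\cap I\big)>0$ for every $\alpha\in\partial\mathbb D$ and every arc $I\subset\partial\mathbb D$.
   Context: $D_h(f)(z)=\frac{(1-|z|^2)|f'(z)|}{1-|f(z)|^2}$. An inner function is a bounded analytic function on $\mathbb D$ with radial limits of modulus $1$ a.e. on $\partial\mathbb D$; $f^{-1}(\{\alpha\})=\{\xi\in\partial\mathbb D:\lim_{r\to1}f(r\xi)=\alpha\}$. For $0<s\le1$, $M^s(F)=\inf\{\sum_j|I_j|^s: F\subset\bigcup_j I_j,\ I_j \text{ arcs}\}$ is the $s$-dimensional Hausdorff content, with $|I|$ the normalized length of $I$. *)

theory Defs
  imports "HOL-Analysis.Analysis"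
begin

definition hyp_deriv :: "(complex \<Rightarrow> complex) \<Rightarrow> complex \<Rightarrow> real" where
  "hyp_deriv f z = (1 - (cmod z)^2) * cmod (deriv f z) / (1 - (cmod (f z))^2)"

definition inner_function :: "(complex \<Rightarrow> complex) \<Rightarrow> bool" where
  "inner_function f \<longleftrightarrow>
     f holomorphic_on ball 0 1 \<and>
     (\<exists>B. \<forall>z\<in>ball 0 1. cmod (f z) \<le> B) \<and>
     (AE t in lborel. t \<in> {0..2*pi} \<longrightarrow>
        (\<exists>L. cmod L = 1 \<and> ((\<lambda>r::real. f (of_real r * cis t)) \<longlongrightarrow> L) (at_left 1)))"

definition radial_preimage :: "(complex \<Rightarrow> complex) \<Rightarrow> complex \<Rightarrow> complex set" where
  "radial_preimage f \<alpha> =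
     {\<xi> \<in> sphere 0 1. ((\<lambda>r::real. f (of_real r * \<xi>)) \<longlongrightarrow> \<alpha>) (at_left 1)}"

definition arc :: "real \<Rightarrow> real \<Rightarrow> complex set" where
  "arc a b = cis ` {a..b}"

definition hcontent :: "real \<Rightarrow> complex set \<Rightarrow> ennreal" where
  "hcontent s F = (INF ab \<in> {ab :: nat \<Rightarrow> real \<times> real.
        (\<forall>j. fst (ab j) \<le> snd (ab j) \<and> snd (ab j) - fst (ab j) \<le> 2*pi) \<and>
        F \<subseteq> (\<Union>j. arc (fst (ab j)) (snd (ab j)))}.
      (\<Sum>j. ennreal (((snd (ab j) - fst (ab j)) / (2*pi)) powr s)))"

end

theory Submission
  imports Defs "HOL-Complex_Analysis.Complex_Analysis"
begin

text \<open>
  The Cayley transform \<open>g = (\<alpha> + f) / (\<alpha> - f)\<close> has positive real part \<open>u\<close>, and the bound on the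
  hyperbolic derivative says \<open>(1 - |z|\<^sup>2) |\<nabla>u| \<le> 2 D u\<close>. Hence \<open>u\<close> lies between constant multiples of
  \<open>(1 - |z|)\<^sup>D\<close> and \<open>(1 - |z|)\<close> to the power \<open>-D\<close>. By the upper bound, the measures
  \<open>u(R e\<^sup>i\<^sup>t) dt\<close> are uniformly Hoelder of exponent \<open>1 - D\<close>, so that Arzela--Ascoli yields a limit measure
  \<open>\<mu>\<close> as \<open>R \<rightarrow> 1\<close> with the same Hoelder bound (the Aleksandrov--Clark measure of \<open>f\<close>). By the lower bound, \<open>\<mu>\<close> charges
  every arc: otherwise the Poisson formula would make \<open>u\<close> of order \<open>1 - |z|\<close> near its midpoint.
  Since \<open>f\<close> is inner, \<open>u\<close> has radial limit \<open>0\<close> almost everywhere, and at points where \<open>f\<close> does not tend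
  to \<open>\<alpha>\<close> radially the lower limit of \<open>u\<close> is finite; comparing \<open>\<mu>\<close> with Lebesgue measure on short
  intervals shows that \<open>\<mu>\<close> is carried by the radial preimage of \<open>\<alpha>\<close>, and the mass distribution principle
  applies.
\<close>

section \<open>The Poisson formula\<close>

lemma poisson_formula_0:
  fixes h :: "complex \<Rightarrow> complex"
  assumes h: "h holomorphic_on ball 0 1" and R: "R < 1" and z: "cmod z < R"
  shows "((\<lambda>t. h (of_real R * cis t) * of_real ((R\<^sup>2 - (cmod z)\<^sup>2) / (cmod (of_real R * cis t - z))\<^sup>2))
           has_integral (2 * of_real pi * h z)) {0..2*pi}"
proof -
  have R0: "0 < R" using z norm_ge_zero[of z] by linarith
  have den: "of_real (R\<^sup>2) - cnj z * w \<noteq> 0" if "w \<in> cball 0 R" for w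
  proof
    assume "of_real (R\<^sup>2) - cnj z * w = 0"
    then have "cmod (of_real (R\<^sup>2)) = cmod (cnj z * w)" by simp
    then have "R\<^sup>2 = cmod z * cmod w" by (simp add: norm_mult norm_power)
    also have "\<dots> \<le> cmod z * R" using that by (intro mult_left_mono) auto
    also have "\<dots> < R * R" using z R0 by simp
    finally show False by (simp add: power2_eq_square)
  qed
  \<comment> \<open>Cauchy's formula for this \<open>k\<close> is the Poisson formula, since \<open>k z = h z\<close> and
    \<open>R\<^sup>2 - cnj z * w = w * cnj (w - z)\<close> on the circle.\<close>
  define k where "k = (\<lambda>w. h w * of_real (R\<^sup>2 - (cmod z)\<^sup>2) / (of_real (R\<^sup>2) - cnj z * w))"
  have "k holomorphic_on cball 0 R"
    unfolding k_def using den R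
    by (intro holomorphic_intros holomorphic_on_subset[OF h]) auto
  then have "((\<lambda>u. k u/(u-z)) has_contour_integral (2 * of_real pi * \<i> * k z)) (circlepath 0 R)"
    using z by (intro Cauchy_integral_circlepath_simple) auto
  then have "((\<lambda>t. k (of_real R * cis t) / (of_real R * cis t - z) * of_real R * \<i> * cis t)
      has_integral (2 * of_real pi * \<i> * k z)) {0..2*pi}"
    unfolding circlepath_def by (subst (asm) has_contour_integral_part_circlepath_iff) auto
  moreover have "k z = h z"
  proof -
    have "of_real (R\<^sup>2 - (cmod z)\<^sup>2) = of_real (R\<^sup>2) - cnj z * z"
      by (metis complex_norm_square mult.commute of_real_diff of_real_power)
    then show ?thesis using den[of z] z by (simp add: k_def)
  qed
  ultimately have "((\<lambda>t. (- \<i>) * (k (of_real R * cis t) / (of_real R * cis t - z) * of_real R * \<i> * cis t))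
      has_integral ((- \<i>) * (2 * of_real pi * \<i> * h z))) {0..2*pi}"
    by (intro has_integral_mult_right) simp
  then have "((\<lambda>t. k (of_real R * cis t) / (of_real R * cis t - z) * (of_real R * cis t))
      has_integral (2 * of_real pi * h z)) {0..2*pi}"
    by (simp add: mult_ac)
  moreover have "k (of_real R * cis t) / (of_real R * cis t - z) * (of_real R * cis t)
     = h (of_real R * cis t) * of_real ((R\<^sup>2 - (cmod z)\<^sup>2) / (cmod (of_real R * cis t - z))\<^sup>2)" for t
  proof -
    define w where "w = of_real R * cis t"
    have w: "of_real (R\<^sup>2) = cnj w * w"
      by (simp add: w_def power2_eq_square cis_cnj cis_mult)
    have w0: "w \<noteq> 0" using R0 by (simp add: w_def)
    have wz: "w - z \<noteq> 0" using z R0 by (auto simp: w_def norm_mult)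
    have sq: "of_real ((cmod (w - z))\<^sup>2) = (w - z) * (cnj w - cnj z)"
      unfolding complex_norm_square by simp
    have dn: "of_real (R\<^sup>2) - cnj z * w = (cnj w - cnj z) * w" unfolding w by (simp add: algebra_simps)
    have "cnj w - cnj z \<noteq> 0" using wz by (metis complex_cnj_diff complex_cnj_zero_iff)
    then have "h w * X / ((cnj w - cnj z) * w) / (w - z) * w = h w * (X / ((w - z) * (cnj w - cnj z)))" for X
      using w0 wz by (simp add: mult_ac)
    then show ?thesis
      unfolding w_def[symmetric] k_def of_real_divide sq dn .
  qed
  ultimately show ?thesis by simp
qed

text \<open>Rotation by \<open>cis c\<close> carries \<open>poisson_formula_0\<close> over to a
  parameter interval with any starting point. Later estimates start it at \<open>x - pi\<close>, so
  that an arc around \<open>cis x\<close> lies in the middle.\<close>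

lemma poisson_formula:
  fixes h :: "complex \<Rightarrow> complex"
  assumes h: "h holomorphic_on ball 0 1" and R: "R < 1" and z: "cmod z < R"
  shows "((\<lambda>t. h (of_real R * cis t) * of_real ((R\<^sup>2 - (cmod z)\<^sup>2) / (cmod (of_real R * cis t - z))\<^sup>2))
           has_integral (2 * of_real pi * h z)) {c..c + 2*pi}"
proof -
  have 1: "(\<lambda>w. h (w * cis c)) holomorphic_on ball 0 1"
    by (rule holomorphic_on_compose_gen[of "\<lambda>w. w * cis c" _ h "ball 0 1", unfolded o_def, OF _ h])
       (auto intro!: holomorphic_intros simp: norm_mult)
  have z': "cmod (z * cis (-c)) < R" using z by (simp add: norm_mult)
  have e: "cmod (of_real R * cis t - z * cis (-c)) = cmod (of_real R * cis (c + t) - z)" for t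
  proof -
    have "cmod (of_real R * cis (c + t) - z) = cmod ((of_real R * cis t - z * cis (-c)) * cis c)"
      by (simp add: left_diff_distrib mult.assoc cis_mult add.commute)
    then show ?thesis by (simp add: norm_mult)
  qed
  show ?thesis
    using poisson_formula_0[OF 1 R z']
      has_integral_shift_Icc_real[of "\<lambda>t. h (of_real R * cis t) * of_real ((R\<^sup>2 - (cmod z)\<^sup>2) / (cmod (of_real R * cis t - z))\<^sup>2)" c _ 0 "2*pi"]
    unfolding e by (simp add: norm_mult mult.assoc cis_mult o_def add_ac)
qed

lemma poisson_formula_Re:
  fixes h :: "complex \<Rightarrow> complex"
  assumes h: "h holomorphic_on ball 0 1" and R: "R < 1" and z: "cmod z < R"
  shows "((\<lambda>t. Re (h (of_real R * cis t)) * ((R\<^sup>2 - (cmod z)\<^sup>2) / (cmod (of_real R * cis t - z))\<^sup>2))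
           has_integral (2 * pi * Re (h z))) {c..c + 2*pi}"
  using has_integral_linear[OF poisson_formula[OF assms] bounded_linear_Re]
  by (simp add: o_def)

lemma continuous_on_radius_cis:
  fixes h :: "complex \<Rightarrow> 'b::topological_space"
  assumes h: "continuous_on (ball 0 1) h" and R: "0 \<le> R" "R < 1"
  shows "continuous_on S (\<lambda>t. h (of_real R * cis t))"
  by (rule continuous_on_compose2[OF h]) (use R in \<open>auto intro!: continuous_intros simp: norm_mult\<close>)

lemma norm_cis_diff: "cmod (cis t - cis x) = 2 * \<bar>sin ((t - x) / 2)\<bar>"
proof -
  have "cis t - cis x = cis x * (exp (\<i> * of_real (t - x)) - 1)"
    by (simp only: cis_conv_exp[symmetric]) (simp add: algebra_simps cis_mult)
  then show ?thesis by (simp only: norm_mult norm_cis dist_exp_i_1)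
qed

text \<open>For the point \<open>z\<close> at relative depth \<open>d\<close> below the midpoint of
  the arc, the Poisson kernel is at least \<open>1 / (4 * d)\<close> on that arc; positivity of
  \<open>Re h\<close> allows the rest of the circle to be dropped.\<close>

lemma integral_Re_le_harmonic:
  fixes h :: "complex \<Rightarrow> complex"
  assumes h: "h holomorphic_on ball 0 1" and pos: "\<And>z. cmod z < 1 \<Longrightarrow> 0 \<le> Re (h z)"
    and R: "0 < R" "R < 1" and d: "0 < d" "d \<le> 1"
  shows "integral {x - d..x + d} (\<lambda>t. Re (h (of_real R * cis t)))
           \<le> 8 * pi * d * Re (h (of_real (R * (1 - d)) * cis x))"
proof -
  define z where "z = of_real (R * (1 - d)) * cis x"
  have nz: "cmod z = R * (1 - d)" using R d unfolding z_def norm_mult norm_of_real by simp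
  have z: "cmod z < R" using R d by (simp add: nz)
  let ?u = "\<lambda>t. Re (h (of_real R * cis t))"
  let ?k = "\<lambda>t. (R\<^sup>2 - (cmod z)\<^sup>2) / (cmod (of_real R * cis t - z))\<^sup>2"
  have P: "((\<lambda>t. ?u t * ?k t) has_integral (2 * pi * Re (h z))) {x - pi..x + pi}"
    using poisson_formula_Re[OF h R(2) z, of "x - pi"] by (simp add: algebra_simps)
  have u0: "?u t \<ge> 0" for t using R by (intro pos) (simp add: norm_mult)
  have sub: "{x - d..x + d} \<subseteq> {x - pi..x + pi}" using d pi_gt3 by auto
  have cu: "continuous_on {x - d..x + d} ?u"
    by (intro continuous_on_Re continuous_on_radius_cis holomorphic_on_imp_continuous_on h) (use R in auto)
  have wz: "of_real R * cis t - z \<noteq> 0" for t using z R by (auto simp: norm_mult)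
  have ku: "(\<lambda>t. ?u t * ?k t) integrable_on {x - d..x + d}"
    by (intro integrable_continuous_real continuous_intros cu) (use wz in auto)
  \<comment> \<open>Moving along the circle and then along the radius reaches \<open>z\<close>
    within distance \<open>2 * R * d\<close>, while \<open>R\<^sup>2 - (cmod z)\<^sup>2\<close> is
    at least \<open>R\<^sup>2 * d\<close>.\<close>
  have low: "1 / (4 * d) \<le> ?k t" if t: "t \<in> {x - d..x + d}" for t
  proof -
    have "cmod (of_real R * cis t - z) \<le> cmod (of_real R * cis t - of_real R * cis x) + cmod (of_real R * cis x - z)"
      by norm
    also have "of_real R * cis x - z = of_real (R * d) * cis x"
      by (simp add: z_def algebra_simps)
    also have "of_real R * cis t - of_real R * cis x = of_real R * (cis t - cis x)"
      by (simp add: algebra_simps)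
    also have "cmod (of_real R * (cis t - cis x)) \<le> R * d"
    proof -
      have "cmod (cis t - cis x) \<le> \<bar>t - x\<bar>"
        using abs_sin_x_le_abs_x[of "(t - x) / 2"] by (simp add: norm_cis_diff)
      also have "\<dots> \<le> d" using t by auto
      finally show ?thesis using R by (simp add: norm_mult)
    qed
    also have "cmod (of_real (R * d) * cis x) = R * d" using R d by (simp add: norm_mult)
    finally have "cmod (of_real R * cis t - z) \<le> 2 * R * d" by simp
    then have "(cmod (of_real R * cis t - z))\<^sup>2 \<le> (2 * R * d)\<^sup>2" by (intro power_mono) auto
    then have A: "(cmod (of_real R * cis t - z))\<^sup>2 \<le> 4 * d * (R\<^sup>2 * d)"
      by (simp add: power2_eq_square mult_ac)
    have "R\<^sup>2 - (cmod z)\<^sup>2 = R\<^sup>2 * (d + d * (1 - d))" by (simp add: nz power2_eq_square algebra_simps)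
    also have "\<dots> \<ge> R\<^sup>2 * d" using d by (intro mult_left_mono) auto
    finally have "(cmod (of_real R * cis t - z))\<^sup>2 \<le> 4 * d * (R\<^sup>2 - (cmod z)\<^sup>2)"
      using A d by (meson mult_left_mono order_trans mult_nonneg_nonneg less_imp_le zero_le_numeral)
    then show ?thesis using wz[of t] d by (simp add: field_simps)
  qed
  have "integral {x - d..x + d} (\<lambda>t. ?u t * (1 / (4 * d))) \<le> integral {x - d..x + d} (\<lambda>t. ?u t * ?k t)"
  proof (rule integral_le)
    show "(\<lambda>t. ?u t * (1 / (4 * d))) integrable_on {x - d..x + d}"
      by (intro integrable_continuous_real continuous_on_mult cu continuous_on_const)
    show "?u t * (1 / (4 * d)) \<le> ?u t * ?k t" if "t \<in> {x - d..x + d}" for t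
      by (rule mult_left_mono[OF low[OF that] u0])
  qed (rule ku)
  also have "\<dots> \<le> integral {x - pi..x + pi} (\<lambda>t. ?u t * ?k t)"
  proof (rule integral_subset_le[OF sub ku])
    show "(\<lambda>t. ?u t * ?k t) integrable_on {x - pi..x + pi}" using P by (rule has_integral_integrable)
    show "\<forall>t\<in>{x - pi..x + pi}. 0 \<le> ?u t * ?k t"
      using z by (intro ballI mult_nonneg_nonneg u0 divide_nonneg_nonneg) (auto intro: power_mono)
  qed
  also have "\<dots> = 2 * pi * Re (h z)" using P by (rule integral_unique)
  finally have "integral {x - d..x + d} ?u * (1 / (4 * d)) \<le> 2 * pi * Re (h z)" by simp
  then show ?thesis using d by (simp add: z_def field_simps)
qed

section \<open>Inner functions and the Schwarz--Pick lemma\<close>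

lemma filterlim_radius_at_left:
  assumes "0 < c"
  shows "filterlim (\<lambda>n. 1 - c / (real n + 2)) (at_left 1) sequentially"
proof -
  have "(\<lambda>n. 1 - c / (real n + 2)) \<longlonglongrightarrow> 1 - 0"
    by (intro tendsto_intros tendsto_divide_0[OF tendsto_const] filterlim_at_top_imp_at_infinity
        filterlim_tendsto_add_at_top[OF tendsto_const filterlim_real_sequentially, of 2, simplified add.commute])
  then show ?thesis using assms
    by (auto simp: filterlim_at intro!: always_eventually divide_pos_pos)
qed

text \<open>On the circle of radius \<open>R n\<close> the modulus of \<open>f\<close> is at most
  \<open>1 + w n\<close>, where \<open>w n\<close> is the excess over 1. The excess tends to 0
  almost everywhere and is bounded by \<open>\<bar>B\<bar>\<close>, so dominated convergence removes
  it from the Poisson formula in the limit.\<close>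

lemma norm_le_1_if_radial_limits:
  fixes f :: "complex \<Rightarrow> complex"
  assumes f: "f holomorphic_on ball 0 1" and B: "\<And>z. cmod z < 1 \<Longrightarrow> cmod (f z) \<le> B"
    and lim: "AE t in lborel. t \<in> {0..2*pi} \<longrightarrow>
        (\<exists>L. cmod L = 1 \<and> ((\<lambda>r::real. f (of_real r * cis t)) \<longlongrightarrow> L) (at_left 1))"
    and z: "cmod z < 1"
  shows "cmod (f z) \<le> 1"
proof -
  \<comment> \<open>This scaling keeps every \<open>R n\<close> at least
    \<open>(1 - cmod z) / 2\<close> above \<open>cmod z\<close>, which bounds the Poisson kernels at
    \<open>z\<close> by \<open>K\<close> uniformly in \<open>n\<close>.\<close>
  define R where "R n = 1 - (1 - cmod z) / (real n + 2)" for n :: nat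
  have Rl: "filterlim R (at_left 1) sequentially"
    unfolding R_def[abs_def] using z by (intro filterlim_radius_at_left) simp
  have R1: "R n < 1" for n using z by (simp add: R_def)
  have Rz: "R n - cmod z \<ge> (1 - cmod z) / 2" for n
    using divide_left_mono[of 2 "real n + 2" "1 - cmod z"] z by (simp add: R_def field_simps)
  have zR: "cmod z < R n" for n using Rz[of n] z by (simp add: field_simps)
  have R0: "0 < R n" for n using zR[of n] norm_ge_zero[of z] by linarith
  define w where "w n t = max 0 (cmod (f (of_real (R n) * cis t)) - 1)" for n t
  define K where "K = 1 / ((1 - cmod z) / 2)\<^sup>2"
  define k where "k n t = ((R n)\<^sup>2 - (cmod z)\<^sup>2) / (cmod (of_real (R n) * cis t - z))\<^sup>2" for n t
  have cf: "continuous_on S (\<lambda>t. f (of_real (R n) * cis t))" for n S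
    using R0 R1 by (intro continuous_on_radius_cis holomorphic_on_imp_continuous_on f) (auto intro: less_imp_le)
  have cw: "continuous_on S (w n)" for n S
    unfolding w_def[abs_def] by (intro continuous_intros cf)
  have ne: "cmod (of_real (R n) * cis t - z) \<ge> (1 - cmod z) / 2" for n t
    using norm_triangle_ineq2[of "of_real (R n) * cis t" z] Rz[of n] R0[of n] by (simp add: norm_mult)
  have pos: "cmod (of_real (R n) * cis t - z) > 0" for n t using z by (intro less_le_trans[OF _ ne]) simp
  have k0: "0 \<le> k n t" for n t
    unfolding k_def using zR[of n] by (intro divide_nonneg_nonneg) (auto intro: power_mono less_imp_le)
  have kK: "k n t \<le> K" for n t
    unfolding k_def K_def
  proof (rule frac_le)
    have "(R n)\<^sup>2 \<le> 1" using R0[of n] R1[of n] by (simp add: power_le_one)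
    then show "(R n)\<^sup>2 - (cmod z)\<^sup>2 \<le> 1" using zero_le_power2[of "cmod z"] by linarith
    show "((1 - cmod z) / 2)\<^sup>2 \<le> (cmod (of_real (R n) * cis t - z))\<^sup>2"
      using ne z by (intro power_mono) auto
  qed (use z in auto)
  have ck: "continuous_on S (k n)" for n S
    unfolding k_def[abs_def] using pos by (intro continuous_intros) (auto simp: less_le)
  have le: "2 * pi * cmod (f z) \<le> 2 * pi + K * integral {0..2*pi} (w n)" for n
  proof -
    have P: "((\<lambda>t. f (of_real (R n) * cis t) * of_real (k n t)) has_integral (2 * of_real pi * f z)) {0..2*pi}"
      using poisson_formula[OF f R1 zR, of n 0] by (simp add: k_def)
    have "2 * pi * cmod (f z) = cmod (2 * of_real pi * f z)" by (simp add: norm_mult)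
    also have "\<dots> = cmod (integral {0..2*pi} (\<lambda>t. f (of_real (R n) * cis t) * of_real (k n t)))"
      using integral_unique[OF P] by simp
    also have "\<dots> \<le> integral {0..2*pi} (\<lambda>t. k n t + K * w n t)"
    proof (rule integral_norm_bound_integral)
      show "(\<lambda>t. k n t + K * w n t) integrable_on {0..2*pi}"
        by (intro integrable_continuous_real continuous_intros ck cw)
      fix t
      have "cmod (f (of_real (R n) * cis t) * of_real (k n t)) \<le> (1 + w n t) * k n t"
        unfolding norm_mult norm_of_real using k0 by (simp add: w_def mult_right_mono)
      also have "\<dots> \<le> k n t + K * w n t"
        using mult_right_mono[OF kK, of "w n t" n t] by (simp add: w_def algebra_simps)
      finally show "cmod (f (of_real (R n) * cis t) * of_real (k n t)) \<le> k n t + K * w n t" .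
    qed (use P in \<open>rule has_integral_integrable\<close>)
    also have "\<dots> = integral {0..2*pi} (k n) + K * integral {0..2*pi} (w n)"
      by (subst integral_add) (auto intro!: integrable_continuous_real continuous_intros ck cw)
    also have "integral {0..2*pi} (k n) = 2 * pi"
      using poisson_formula_Re[of "\<lambda>_. 1" "R n" z 0] R1 zR
      by (intro integral_unique) (simp add: k_def[abs_def])
    finally show ?thesis .
  qed
  have "(\<lambda>n. LINT t|lborel. indicator {0..2*pi} t *\<^sub>R w n t) \<longlonglongrightarrow> (LINT t|(lborel::real measure). (0::real))"
  proof (rule integral_dominated_convergence[where w = "\<lambda>t. indicator {0..2*pi} t *\<^sub>R \<bar>B\<bar>"])
    show "(\<lambda>t. indicator {0..2*pi} t *\<^sub>R w n t) \<in> borel_measurable lborel" for n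
      using borel_measurable_continuous_onI[OF cw, of n] by measurable
    show "integrable lborel (\<lambda>t::real. indicator {0..2*pi} t *\<^sub>R \<bar>B\<bar>)" by simp
    show "AE t in lborel. norm (indicator {0..2*pi} t *\<^sub>R w n t) \<le> indicator {0..2*pi} t *\<^sub>R \<bar>B\<bar>" for n
    proof (rule AE_I2)
      fix t
      have "cmod (f (of_real (R n) * cis t)) \<le> B" using R0[of n] R1[of n] by (intro B) (simp add: norm_mult)
      then have "w n t \<le> \<bar>B\<bar>" "0 \<le> w n t" by (auto simp: w_def)
      then show "norm (indicator {0..2*pi} t *\<^sub>R w n t) \<le> indicator {0..2*pi} t *\<^sub>R \<bar>B\<bar>"
        by (simp add: indicator_def)
    qed
    show "AE t in lborel. (\<lambda>n. indicator {0..2*pi} t *\<^sub>R w n t) \<longlonglongrightarrow> 0"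
      using lim
    proof eventually_elim
      case (elim t)
      show ?case
      proof (cases "t \<in> {0..2*pi}")
        case True
        then obtain L where L: "cmod L = 1" "((\<lambda>r::real. f (of_real r * cis t)) \<longlongrightarrow> L) (at_left 1)"
          using elim by blast
        have "(\<lambda>n. f (of_real (R n) * cis t)) \<longlonglongrightarrow> L" by (rule filterlim_compose[OF L(2) Rl])
        then have "(\<lambda>n. w n t) \<longlonglongrightarrow> max 0 (cmod L - 1)" unfolding w_def by (intro tendsto_intros)
        then show ?thesis using True L(1) by simp
      qed simp
    qed
  qed simp
  then have "(\<lambda>n. integral {0..2*pi} (w n)) \<longlonglongrightarrow> 0"
    using set_borel_integral_eq_integral(2)[OF borel_integrable_atLeastAtMost'[OF cw]]
    by (simp add: set_lebesgue_integral_def)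
  then have "(\<lambda>n. 2 * pi + K * integral {0..2*pi} (w n)) \<longlonglongrightarrow> 2 * pi + K * 0"
    by (intro tendsto_intros)
  then have "2 * pi * cmod (f z) \<le> 2 * pi + K * 0"
    by (rule LIMSEQ_le_const) (use le in auto)
  then show ?thesis by simp
qed

text \<open>The maximum modulus principle makes the bound strict. Unimodular constants satisfy
  \<open>inner_function\<close> and are the case to exclude: for them the denominator in
  \<open>hyp_deriv\<close> is 0.\<close>

lemma inner_function_norm_less_1:
  assumes f: "inner_function f" and nc: "\<not> (\<exists>c. \<forall>z\<in>ball 0 1. f z = c)" and z: "cmod z < 1"
  shows "cmod (f z) < 1"
proof (rule ccontr)
  assume "\<not> cmod (f z) < 1"
  have hol: "f holomorphic_on ball 0 1" using f by (simp add: inner_function_def)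
  have "cmod (f w) \<le> 1" if "cmod w < 1" for w
    using f that unfolding inner_function_def by (elim conjE exE, intro norm_le_1_if_radial_limits[of f]) auto
  then have "cmod (f w) \<le> cmod (f z)" if "w \<in> ball 0 1" for w
    using that \<open>\<not> cmod (f z) < 1\<close> by (meson mem_ball_0 not_le order_trans)
  then have "f constant_on ball 0 1"
    using z by (intro maximum_modulus_principle[OF hol, of "ball 0 1" z]) auto
  then show False using nc by (auto simp: constant_on_def)
qed

text \<open>Disc automorphisms \<open>m\<close> and \<open>p\<close> with \<open>m 0 = z\<close> and
  \<open>p (f z) = 0\<close> reduce the claim to the Schwarz lemma at the origin:
  \<open>deriv q 0\<close> for \<open>q = p \<circ> f \<circ> m\<close> has modulus
  \<open>hyp_deriv f z\<close>.\<close>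

lemma schwarz_pick:
  assumes f: "f holomorphic_on ball 0 1" and lt: "\<And>z. cmod z < 1 \<Longrightarrow> cmod (f z) < 1" and z: "cmod z < 1"
  shows "hyp_deriv f z \<le> 1"
proof -
  define m where "m = (\<lambda>w. (w + z) / (1 + cnj z * w))"
  define p where "p = (\<lambda>w. (w - f z) / (1 - cnj (f z) * w))"
  have mob: "1 + cnj a * w \<noteq> 0 \<and> cmod ((w + a) / (1 + cnj a * w)) < 1" if "cmod a < 1" "cmod w < 1" for a w
  proof
    have "cmod (cnj a * w) < 1"
      using mult_strict_mono'[of "cmod a" 1 "cmod w" 1] that by (simp add: norm_mult)
    then show n: "1 + cnj a * w \<noteq> 0" by (metis add_eq_0_iff norm_minus_cancel norm_one less_irrefl)
    have "of_real ((cmod (1 + cnj a * w))\<^sup>2 - (cmod (w + a))\<^sup>2) = complex_of_real ((1 - (cmod a)\<^sup>2) * (1 - (cmod w)\<^sup>2))"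
      unfolding of_real_diff of_real_mult complex_norm_square by (simp add: algebra_simps)
    then have "(cmod (1 + cnj a * w))\<^sup>2 - (cmod (w + a))\<^sup>2 = (1 - (cmod a)\<^sup>2) * (1 - (cmod w)\<^sup>2)"
      using of_real_eq_iff by blast
    moreover have "\<dots> > 0" using that by (simp add: power_less_one_iff abs_square_less_1)
    ultimately have "(cmod (w + a))\<^sup>2 < (cmod (1 + cnj a * w))\<^sup>2" by linarith
    then have "cmod (w + a) < cmod (1 + cnj a * w)" by (rule power_less_imp_less_base) simp
    then show "cmod ((w + a) / (1 + cnj a * w)) < 1" using n by (simp add: norm_divide)
  qed
  have m: "1 + cnj z * w \<noteq> 0" "cmod (m w) < 1" if "cmod w < 1" for w
    using mob[OF z that] by (auto simp: m_def)
  have p: "1 - cnj (f z) * w \<noteq> 0" "cmod (p w) < 1" if "cmod w < 1" for w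
    using mob[of "- f z" w] lt[OF z] that by (auto simp: p_def)
  have hm: "m holomorphic_on ball 0 1" unfolding m_def using m by (intro holomorphic_intros) auto
  have hp: "p holomorphic_on ball 0 1" unfolding p_def using p by (intro holomorphic_intros) auto
  define q where "q = p \<circ> f \<circ> m"
  have hq: "q holomorphic_on ball 0 1"
    unfolding q_def comp_assoc using m lt
    by (intro holomorphic_on_compose_gen[OF _ hp] holomorphic_on_compose_gen[OF hm f]) auto
  have q0: "q 0 = 0" by (simp add: q_def m_def p_def)
  have "cmod (deriv q 0) \<le> 1"
    by (rule Schwarz_Lemma(2)[OF hq q0, of 0]) (auto simp: q_def intro!: p m lt)
  have m0: "m 0 = z" by (simp add: m_def)
  have "(m has_field_derivative (1 - z * cnj z)) (at 0)"
    unfolding m_def by (auto intro!: derivative_eq_intros)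
  moreover have "(f has_field_derivative deriv f z) (at (m 0))"
    unfolding m0 using f z by (intro holomorphic_derivI[of _ "ball 0 1"]) auto
  moreover have "(p has_field_derivative (1 / (1 - f z * cnj (f z)))) (at (f (m 0)))"
  proof -
    have "(p has_field_derivative (1 * (1 - cnj (f z) * f z) - (f z - f z) * (0 - cnj (f z) * 1)) /
        ((1 - cnj (f z) * f z) * (1 - cnj (f z) * f z))) (at (f z))"
      unfolding p_def using p(1)[OF lt[OF z]]
      by (intro DERIV_divide) (auto intro!: derivative_eq_intros)
    then show ?thesis using p(1)[OF lt[OF z]] by (simp add: m0 mult.commute)
  qed
  ultimately have "(q has_field_derivative (1 / (1 - f z * cnj (f z)) * (deriv f z * (1 - z * cnj z)))) (at 0)"
    unfolding q_def comp_assoc by (intro DERIV_chain) (auto simp: o_def)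
  then have "deriv q 0 = 1 / (1 - f z * cnj (f z)) * (deriv f z * (1 - z * cnj z))"
    by (rule DERIV_imp_deriv)
  also have "1 - f z * cnj (f z) = of_real (1 - (cmod (f z))\<^sup>2)" unfolding of_real_diff complex_norm_square by simp
  also have "1 - z * cnj z = of_real (1 - (cmod z)\<^sup>2)" unfolding of_real_diff complex_norm_square by simp
  finally have "cmod (deriv q 0) = 1 / \<bar>1 - (cmod (f z))\<^sup>2\<bar> * (cmod (deriv f z) * \<bar>1 - (cmod z)\<^sup>2\<bar>)"
    by (simp only: norm_mult norm_divide norm_of_real norm_one)
  moreover have "\<bar>1 - (cmod (f z))\<^sup>2\<bar> = 1 - (cmod (f z))\<^sup>2" "\<bar>1 - (cmod z)\<^sup>2\<bar> = 1 - (cmod z)\<^sup>2"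
    using lt[OF z] z by (auto simp: abs_square_le_1 less_imp_le)
  ultimately show ?thesis using \<open>cmod (deriv q 0) \<le> 1\<close> by (simp add: hyp_deriv_def mult.commute)
qed

text \<open>A supremum of reals is known to bound its family only when the family is bounded above;
  the Schwarz--Pick bound 1 supplies this.\<close>

lemma hyp_deriv_le_SUP:
  assumes f: "f holomorphic_on ball 0 1" and lt: "\<And>z. cmod z < 1 \<Longrightarrow> cmod (f z) < 1" and z: "cmod z < 1"
  shows "hyp_deriv f z \<le> (SUP z\<in>ball 0 1. hyp_deriv f z)"
proof (rule cSUP_upper)
  show "bdd_above (hyp_deriv f ` ball 0 1)"
    by (rule bdd_aboveI2[where M=1]) (simp add: schwarz_pick[OF f lt])
qed (use z in simp)

section \<open>Almost everywhere statements on the circle\<close>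

lemma AE_not_radially_infinite:
  fixes h :: "complex \<Rightarrow> complex"
  assumes h: "h holomorphic_on ball 0 1" and pos: "\<And>z. cmod z < 1 \<Longrightarrow> 0 \<le> Re (h z)"
  shows "AE t in lborel. t \<in> {0..2*pi} \<longrightarrow> \<not> filterlim (\<lambda>r::real. Re (h (of_real r * cis t))) at_top (at_left 1)"
proof -
  define R where "R n = 1 - 1 / (real n + 2)" for n :: nat
  have Rl: "filterlim R (at_left 1) sequentially"
    unfolding R_def[abs_def] by (intro filterlim_radius_at_left) simp
  have R: "0 < R n" "R n < 1" for n by (auto simp: R_def field_simps)
  define v where "v n t = ennreal (Re (h (of_real (R n) * cis t))) * indicator {0..2*pi} t" for n t
  have c: "continuous_on UNIV (\<lambda>t. Re (h (of_real (R n) * cis t)))" for n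
    by (intro continuous_on_Re continuous_on_radius_cis holomorphic_on_imp_continuous_on h) (use R[of n] in auto)
  have mv: "v n \<in> borel_measurable lborel" for n
    unfolding v_def[abs_def] using borel_measurable_continuous_onI[OF c, of n] by measurable
  have "integral\<^sup>N lborel (v n) = ennreal (2 * pi * Re (h 0))" for n
    unfolding v_def[abs_def]
  proof (rule nn_integral_has_integral_lebesgue')
    show "0 \<le> Re (h (of_real (R n) * cis t))" for t using R[of n] by (intro pos) (simp add: norm_mult)
    show "((\<lambda>t. Re (h (of_real (R n) * cis t))) has_integral 2 * pi * Re (h 0)) {0..2*pi}"
      using poisson_formula_Re[OF h R(2), of 0 n 0] R[of n] by (simp add: norm_mult)
  qed
  \<comment> \<open>Fatou's lemma: all circle integrals equal \<open>2 * pi * Re (h 0)\<close>, so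
    the lower limit is integrable and hence finite almost everywhere.\<close>
  then have "(\<integral>\<^sup>+t. liminf (\<lambda>n. v n t) \<partial>lborel) \<le> ennreal (2 * pi * Re (h 0))"
    using nn_integral_liminf[of v lborel, OF mv] by (simp add: Liminf_const)
  then have "(\<integral>\<^sup>+t. liminf (\<lambda>n. v n t) \<partial>lborel) \<noteq> \<infinity>"
    by (metis ennreal_neq_top infinity_ennreal_def neq_top_trans)
  then have "AE t in lborel. liminf (\<lambda>n. v n t) \<noteq> \<infinity>"
    by (intro nn_integral_PInf_AE borel_measurable_liminf mv)
  then show ?thesis
  proof eventually_elim
    case (elim t)
    show ?case
    proof (intro impI notI)
      assume t: "t \<in> {0..2*pi}" and "filterlim (\<lambda>r::real. Re (h (of_real r * cis t))) at_top (at_left 1)"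
      then have "filterlim (\<lambda>n. Re (h (of_real (R n) * cis t))) at_top sequentially"
        using filterlim_compose Rl by blast
      then have "(\<lambda>n. v n t) \<longlonglongrightarrow> top"
        using t by (simp add: v_def ennreal_tendsto_top_eq_at_top)
      then have "liminf (\<lambda>n. v n t) = top" by (intro lim_imp_Liminf) auto
      then show False using elim by simp
    qed
  qed
qed

text \<open>The translates of the exceptional set by integer multiples of \<open>2 * pi\<close> are
  countably many null sets, so one null set contains them all.\<close>

lemma AE_periodic:
  fixes P :: "real \<Rightarrow> bool"
  assumes per: "\<And>t k. P (t + 2 * pi * of_int k) \<longleftrightarrow> P t" and P: "AE t in lborel. t \<in> {0..2*pi} \<longrightarrow> P t"
  shows "AE t in lborel. P t"
proof -
  obtain N where "N \<in> null_sets lborel" "{t \<in> space lborel. \<not> (t \<in> {0..2*pi} \<longrightarrow> P t)} \<subseteq> N"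
    using P unfolding eventually_ae_filter by blast
  then have N: "N \<in> null_sets lborel" "\<And>t. t \<in> {0..2*pi} \<Longrightarrow> \<not> P t \<Longrightarrow> t \<in> N" by auto
  have "AE t in lborel. 2 * pi * of_int k + t \<notin> N" for k
  proof -
    have "AE t in distr lborel borel ((+) (2 * pi * of_int k)). t \<notin> N"
      using AE_not_in[OF N(1)] by (simp only: lborel_distr_plus)
    then show ?thesis using N(1) by (subst (asm) AE_distr_iff) auto
  qed
  then have "AE t in lborel. \<forall>k::int. 2 * pi * of_int k + t \<notin> N" by (simp add: AE_all_countable)
  then show ?thesis
  proof eventually_elim
    case (elim t)
    define k where "k = - \<lfloor>t / (2 * pi)\<rfloor>"
    have "2 * pi * of_int \<lfloor>t / (2 * pi)\<rfloor> \<le> 2 * pi * (t / (2 * pi))"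
      "2 * pi * (t / (2 * pi)) \<le> 2 * pi * (of_int \<lfloor>t / (2 * pi)\<rfloor> + 1)"
      by (intro mult_left_mono; use floor_correct[of "t / (2 * pi)"] in simp)+
    then have "2 * pi * of_int k + t \<in> {0..2*pi}" by (simp add: k_def algebra_simps)
    then show ?case using elim N(2)[of "2 * pi * of_int k + t"] per[of t k] by (auto simp: add.commute)
  qed
qed

section \<open>Positive harmonic functions of slow growth\<close>

text \<open>\<open>cmod (deriv h z)\<close> is the length of the gradient of \<open>Re h\<close>, so
  \<open>grad\<close> bounds the hyperbolic gradient of \<open>ln (Re h)\<close>. The Cayley
  transform of \<open>f\<close> will be the instance, with \<open>D\<close> the supremum of
  \<open>hyp_deriv f\<close>.\<close>

locale slow_growth =
  fixes h :: "complex \<Rightarrow> complex" and D :: real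
  assumes hol: "h holomorphic_on ball 0 1"
    and pos: "cmod z < 1 \<Longrightarrow> 0 < Re (h z)"
    and grad: "cmod z < 1 \<Longrightarrow> (1 - (cmod z)\<^sup>2) * cmod (deriv h z) \<le> 2 * D * Re (h z)"
    and D: "0 \<le> D" "D < 1"
begin

section \<open>Growth along radii\<close>

lemma Re_radial_derivative:
  assumes "0 \<le> x" "x < 1"
  shows "((\<lambda>x::real. Re (h (of_real x * cis t))) has_real_derivative Re (cis t * deriv h (of_real x * cis t))) (at x)"
proof -
  have 1: "((\<lambda>x::real. of_real x * cis t) has_vector_derivative cis t) (at x)"
    by (auto intro!: derivative_eq_intros simp: has_vector_derivative_def scaleR_conv_of_real)
  have 2: "(h has_field_derivative deriv h (of_real x * cis t)) (at (of_real x * cis t))"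
    using assms by (intro holomorphic_derivI[OF hol]) (auto simp: norm_mult)
  show ?thesis
    using bounded_linear.has_vector_derivative[OF bounded_linear_Re field_vector_diff_chain_at[OF 1 2]]
    by (simp add: has_real_derivative_iff_has_vector_derivative o_def)
qed

lemma abs_log_derivative_le:
  assumes "0 \<le> x" "x < 1"
  shows "\<bar>Re (cis t * deriv h (of_real x * cis t)) / Re (h (of_real x * cis t))\<bar> \<le> D * (1 / (1 + x) + 1 / (1 - x))"
proof -
  let ?z = "of_real x * cis t"
  have z: "cmod ?z = x" using assms by (simp add: norm_mult)
  have p: "0 < Re (h ?z)" using assms z by (intro pos) simp
  have x2: "0 < 1 - x\<^sup>2" using assms by (simp add: power_less_one_iff abs_square_less_1)
  have "\<bar>Re (cis t * deriv h ?z)\<bar> \<le> cmod (deriv h ?z)"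
    using abs_Re_le_cmod[of "cis t * deriv h ?z"] by (simp add: norm_mult)
  also have "\<dots> \<le> 2 * D * Re (h ?z) / (1 - x\<^sup>2)"
    using grad[of ?z] z assms x2 by (simp add: field_simps)
  finally have "\<bar>Re (cis t * deriv h ?z)\<bar> / Re (h ?z) \<le> 2 * D / (1 - x\<^sup>2)"
    using p by (simp add: field_simps)
  \<comment> \<open>Partial fractions turn the bound into \<open>D\<close> times the derivative of
    \<open>ln (1 + x) - ln (1 - x)\<close>, ready for integration along the radius.\<close>
  also have "2 * D / (1 - x\<^sup>2) = D * (1 / (1 + x) + 1 / (1 - x))"
  proof -
    have "1 - x\<^sup>2 = (1 + x) * (1 - x)" by (simp add: power2_eq_square algebra_simps)
    then show ?thesis using assms by (simp add: field_simps)
  qed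
  finally show ?thesis using p by simp
qed

lemma growth:
  assumes r: "0 \<le> r" "r < 1"
  shows growth_upper: "Re (h (of_real r * cis t)) \<le> Re (h 0) * ((1 + r) / (1 - r)) powr D"
    and growth_lower: "Re (h 0) * ((1 - r) / (1 + r)) powr D \<le> Re (h (of_real r * cis t))"
proof -
  let ?u = "\<lambda>x::real. Re (h (of_real x * cis t))"
  have p: "0 < ?u x" if "0 \<le> x" "x \<le> r" for x using that r by (intro pos) (simp add: norm_mult)
  have p0: "0 < Re (h 0)" by (intro pos) simp
  \<comment> \<open>By \<open>abs_log_derivative_le\<close> this derivative is nonpositive for
    \<open>c = D\<close>, which yields the upper bound, and nonnegative for \<open>c = - D\<close>,
    which yields the lower bound.\<close>
  have der: "((\<lambda>x. ln (?u x) - c * (ln (1 + x) - ln (1 - x))) has_real_derivative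
      Re (cis t * deriv h (of_real x * cis t)) / ?u x - c * (1 / (1 + x) + 1 / (1 - x))) (at x)"
    if "0 \<le> x" "x \<le> r" for x c
  proof -
    have "x < 1" using that r by simp
    have "((\<lambda>x. ln (?u x)) has_real_derivative Re (cis t * deriv h (of_real x * cis t)) / ?u x) (at x)"
      using DERIV_chain2[OF DERIV_ln[OF p[OF that]] Re_radial_derivative[OF that(1) \<open>x < 1\<close>]]
      by (simp add: divide_inverse mult.commute)
    moreover have "((\<lambda>x. c * (ln (1 + x) - ln (1 - x))) has_real_derivative c * (1 / (1 + x) + 1 / (1 - x))) (at x)"
      using that(1) \<open>x < 1\<close> by (auto intro!: derivative_eq_intros)
    ultimately show ?thesis by (rule DERIV_diff)
  qed
  have "ln (?u r) - D * (ln (1 + r) - ln (1 - r)) \<le> ln (?u 0) - D * (ln (1 + 0) - ln (1 - 0))"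
  proof (rule DERIV_nonpos_imp_nonincreasing[OF r(1)])
    fix x assume x: "0 \<le> x" "x \<le> r"
    have "x < 1" using x r by simp
    show "\<exists>y. DERIV (\<lambda>x. ln (?u x) - D * (ln (1 + x) - ln (1 - x))) x :> y \<and> y \<le> 0"
      using der[OF x, of D] abs_le_D1[OF abs_log_derivative_le[OF x(1) \<open>x < 1\<close>, of t]]
      by (intro exI conjI) auto
  qed
  then have "ln (?u r) \<le> ln (Re (h 0)) + D * ln ((1 + r) / (1 - r))" using r by (simp add: ln_div)
  then have "exp (ln (?u r)) \<le> exp (ln (Re (h 0)) + D * ln ((1 + r) / (1 - r)))" by simp
  then show "?u r \<le> Re (h 0) * ((1 + r) / (1 - r)) powr D"
    using p[OF r(1) order_refl] p0 r by (simp add: exp_add powr_def)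
  have "ln (?u 0) - (- D) * (ln (1 + 0) - ln (1 - 0)) \<le> ln (?u r) - (- D) * (ln (1 + r) - ln (1 - r))"
  proof (rule DERIV_nonneg_imp_nondecreasing[OF r(1)])
    fix x assume x: "0 \<le> x" "x \<le> r"
    have "x < 1" using x r by simp
    show "\<exists>y. DERIV (\<lambda>x. ln (?u x) - (- D) * (ln (1 + x) - ln (1 - x))) x :> y \<and> y \<ge> 0"
      using der[OF x, of "- D"] abs_le_D2[OF abs_log_derivative_le[OF x(1) \<open>x < 1\<close>, of t]]
      by (intro exI conjI) auto
  qed
  then have "ln (Re (h 0)) + D * ln ((1 - r) / (1 + r)) \<le> ln (?u r)" using r by (simp add: ln_div algebra_simps)
  then have "exp (ln (Re (h 0)) + D * ln ((1 - r) / (1 + r))) \<le> exp (ln (?u r))" by simp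
  then show "Re (h 0) * ((1 - r) / (1 + r)) powr D \<le> ?u r"
    using p[OF r(1) order_refl] p0 r by (simp add: exp_add powr_def)
qed

section \<open>Masses of arcs and the limit measure on the boundary\<close>

lemma continuous_on_Re_circle:
  assumes "0 \<le> R" "R < 1"
  shows "continuous_on S (\<lambda>t. Re (h (of_real R * cis t)))"
  using assms by (intro continuous_on_Re continuous_on_radius_cis holomorphic_on_imp_continuous_on hol)

text \<open>\<open>integral_Re_le_harmonic\<close> bounds the mass of an arc of half-length
  \<open>d\<close> by a multiple of \<open>d\<close> times a value of \<open>Re h\<close> at radius
  at most \<open>1 - d\<close>, and \<open>growth_upper\<close> bounds that value by a multiple of
  \<open>d powr - D\<close>. The exponents combine to \<open>1 - D\<close>, with a constant
  independent of \<open>R\<close>.\<close>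

lemma integral_Re_hoelder:
  assumes R: "0 < R" "R < 1" and st: "s \<le> t" "t \<le> s + 1"
  shows "integral {s..t} (\<lambda>x. Re (h (of_real R * cis x))) \<le> 16 * pi * Re (h 0) * (t - s) powr (1 - D)"
proof (cases "s = t")
  case False
  define d where "d = (t - s) / 2"
  define x where "x = (s + t) / 2"
  have d: "0 < d" "d \<le> 1" using st False by (auto simp: d_def)
  have e: "s = x - d" "t = x + d" by (auto simp: x_def d_def field_simps)
  have A: "0 < Re (h 0)" by (intro pos) simp
  define \<rho> where "\<rho> = R * (1 - d)"
  have \<rho>: "0 \<le> \<rho>" "\<rho> \<le> 1 - d" using R d by (auto simp: \<rho>_def mult_left_le_one_le)
  have "integral {s..t} (\<lambda>x. Re (h (of_real R * cis x))) \<le> 8 * pi * d * Re (h (of_real \<rho> * cis x))"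
    unfolding e \<rho>_def by (rule integral_Re_le_harmonic[OF hol _ R d]) (auto intro: less_imp_le pos)
  also have "Re (h (of_real \<rho> * cis x)) \<le> Re (h 0) * ((1 + \<rho>) / (1 - \<rho>)) powr D"
    using \<rho> d by (intro growth_upper) auto
  also have "((1 + \<rho>) / (1 - \<rho>)) powr D \<le> (2 / d) powr D"
    using \<rho> d D by (intro powr_mono2 frac_le) auto
  also have "(2 / d) powr D = 2 powr D * d powr - D"
    using d by (simp add: powr_divide powr_minus_divide)
  also have "2 powr D \<le> (2::real) powr 1" using D by (intro powr_mono) auto
  finally have "integral {s..t} (\<lambda>x. Re (h (of_real R * cis x)))
      \<le> 8 * pi * d * (Re (h 0) * (2 powr 1 * d powr - D))"
    using d A by (simp add: mult_left_mono mult_right_mono)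
  also have "\<dots> = 16 * pi * Re (h 0) * d powr (1 - D)"
    using d by (simp add: powr_diff powr_minus_divide)
  also have "d powr (1 - D) \<le> (t - s) powr (1 - D)"
    using d st D by (intro powr_mono2) (auto simp: d_def)
  finally show ?thesis using A by (simp add: mult_left_mono)
qed simp

text \<open>The Poisson kernel of a point near the arc's midpoint is small off the arc and is
  bounded crudely on it. If the arc carries no mass in the limit, the first term alone forces decay
  of order \<open>1 - r\<close>; this is how \<open>F a < F b\<close> is obtained in
  \<open>boundary_distribution\<close>.\<close>

lemma Re_le_outside_arc:
  assumes R: "0 < R" "R < 1" and l: "0 < l" "l \<le> 1" and r: "1 - sin (l / 2) \<le> r" "0 \<le> r" "r < 1"
  shows "2 * pi * Re (h (of_real (R * r) * cis x)) \<le>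
     (1 - r\<^sup>2) / (sin (l / 2))\<^sup>2 * (2 * pi * Re (h 0)) +
     (1 - r\<^sup>2) / (1 - r)\<^sup>2 * integral {x - l..x + l} (\<lambda>t. Re (h (of_real R * cis t)))"
proof -
  let ?u = "\<lambda>t. Re (h (of_real R * cis t))"
  let ?z = "of_real (R * r) * cis x"
  let ?K1 = "(1 - r\<^sup>2) / (sin (l / 2))\<^sup>2" and ?K2 = "(1 - r\<^sup>2) / (1 - r)\<^sup>2"
  let ?T = "{x - pi..x + pi}" and ?S = "{x - l..x + l}"
  have s0: "0 < sin (l / 2)" using l pi_gt3 by (intro sin_gt_zero) auto
  have r2: "0 \<le> 1 - r\<^sup>2" using r by (simp add: power_le_one)
  have nz: "cmod ?z = R * r" using R r unfolding norm_mult norm_of_real by simp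
  have z: "cmod ?z < R" unfolding nz using R r by simp
  have P: "((\<lambda>t. ?u t * ((R\<^sup>2 - (cmod ?z)\<^sup>2) / (cmod (of_real R * cis t - ?z))\<^sup>2))
      has_integral (2 * pi * Re (h ?z))) ?T"
    using poisson_formula_Re[OF hol R(2) z, of "x - pi"] by (simp add: algebra_simps)
  \<comment> \<open>The radius \<open>R\<close> cancels from the kernel, so the bounds below are
    uniform in \<open>R\<close>.\<close>
  have ker: "(R\<^sup>2 - (cmod ?z)\<^sup>2) / (cmod (of_real R * cis t - ?z))\<^sup>2 = (1 - r\<^sup>2) / (cmod (cis t - of_real r * cis x))\<^sup>2" for t
  proof -
    have "of_real R * cis t - ?z = of_real R * (cis t - of_real r * cis x)" by (simp add: algebra_simps)
    then have "cmod (of_real R * cis t - ?z) = R * cmod (cis t - of_real r * cis x)"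
      using R by (simp only: norm_mult norm_of_real)
    moreover have "R\<^sup>2 - (R * r)\<^sup>2 = R\<^sup>2 * (1 - r\<^sup>2)" by (simp add: power_mult_distrib algebra_simps)
    ultimately show ?thesis unfolding nz using R by (simp only: power_mult_distrib) simp
  qed
  have bd: "(1 - r\<^sup>2) / (cmod (cis t - of_real r * cis x))\<^sup>2 \<le> ?K1 + (if t \<in> ?S then ?K2 else 0)" if t: "t \<in> ?T" for t
  proof (cases "t \<in> ?S")
    case True
    have "1 - r \<le> cmod (cis t - of_real r * cis x)"
      using norm_triangle_ineq2[of "cis t" "of_real r * cis x"] r by (simp add: norm_mult)
    then have "(1 - r\<^sup>2) / (cmod (cis t - of_real r * cis x))\<^sup>2 \<le> ?K2"
      using r r2 by (intro divide_left_mono power_mono mult_pos_pos) auto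
    moreover have "0 \<le> ?K1" using r2 by simp
    ultimately show ?thesis using True by simp
  next
    case False
    \<comment> \<open>Off the arc the chord from \<open>cis x\<close> to \<open>cis t\<close> has
      length at least \<open>2 * sin (l / 2)\<close>. The assumption on \<open>r\<close> gives
      \<open>1 - r \<le> sin (l / 2)\<close>, which leaves at least \<open>sin (l / 2)\<close> for
      the distance to \<open>of_real r * cis x\<close>.\<close>
    have "sin (l / 2) \<le> sin (\<bar>t - x\<bar> / 2)"
      using t False l by (intro sin_monotone_2pi_le) (auto simp: abs_if)
    also have "\<dots> \<le> \<bar>sin ((t - x) / 2)\<bar>"
      using sin_minus[of "(t - x) / 2"] by (cases "t < x") (auto simp: abs_if minus_divide_left)
    finally have "2 * sin (l / 2) \<le> cmod (cis t - cis x)" by (simp add: norm_cis_diff)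
    also have "\<dots> \<le> cmod (cis t - of_real r * cis x) + cmod (of_real r * cis x - cis x)" by norm
    also have "of_real r * cis x - cis x = of_real (r - 1) * cis x" by (simp add: algebra_simps)
    also have "cmod (of_real (r - 1) * cis x) = 1 - r" using r unfolding norm_mult norm_of_real by simp
    finally have "sin (l / 2) \<le> cmod (cis t - of_real r * cis x)" using r by linarith
    then have "(1 - r\<^sup>2) / (cmod (cis t - of_real r * cis x))\<^sup>2 \<le> ?K1"
      using s0 r2 by (intro divide_left_mono power_mono mult_pos_pos) auto
    then show ?thesis unfolding if_not_P[OF False] by simp
  qed
  have u0: "0 \<le> ?u t" for t using R by (intro less_imp_le pos) (simp add: norm_mult)
  have M: "(?u has_integral (2 * pi * Re (h 0))) ?T"
    using poisson_formula_Re[OF hol R(2), of 0 "x - pi"] R by (simp add: norm_mult algebra_simps)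
  have "(?u has_integral (integral ?S ?u)) ?S"
    using R by (intro integrable_integral integrable_continuous_real continuous_on_Re_circle) auto
  moreover have "?S \<subseteq> ?T" using l pi_gt3 by auto
  ultimately have I: "((\<lambda>t. if t \<in> ?S then ?u t else 0) has_integral (integral ?S ?u)) ?T"
    by (simp only: has_integral_restrict)
  show ?thesis
  proof (rule has_integral_le[OF P has_integral_add[OF has_integral_mult_right[OF M] has_integral_mult_right[OF I]]])
    fix t assume t: "t \<in> ?T"
    show "?u t * ((R\<^sup>2 - (cmod ?z)\<^sup>2) / (cmod (of_real R * cis t - ?z))\<^sup>2) \<le>
       ?K1 * ?u t + ?K2 * (if t \<in> ?S then ?u t else 0)"
    proof (cases "t \<in> ?S")
      case True
      show ?thesis
        using mult_left_mono[OF bd[OF t] u0[of t]] unfolding ker if_P[OF True]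
        by (simp only: distrib_left mult.commute)
    next
      case False
      show ?thesis
        using mult_left_mono[OF bd[OF t] u0[of t]] unfolding ker if_not_P[OF False]
        by (simp only: mult_zero_right add_0_right mult.commute)
    qed
  qed
qed

text \<open>\<open>F\<close> is the distribution function of the limit measure on
  \<open>[a, b]\<close>. The Hoelder bound serves the mass distribution principle,
  \<open>F a < F b\<close> says that there is mass, and the last bound compares mass with Lebesgue
  measure through radial values of \<open>Re h\<close>.\<close>

lemma boundary_distribution:
  assumes ab: "a < b" "b \<le> a + 1"
  obtains F C where "mono F" "continuous_on UNIV F" "F a < F b" "0 \<le> C"
    "\<And>s t. s \<le> t \<Longrightarrow> F t - F s \<le> C * (t - s) powr (1 - D)"
    "\<And>x d. 0 < d \<Longrightarrow> a \<le> x - d \<Longrightarrow> x + d \<le> b \<Longrightarrow>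
        F (x + d) - F (x - d) \<le> 8 * pi * d * Re (h (of_real (1 - d) * cis x))"
proof -
  define R where "R n = 1 - 1 / (real n + 2)" for n :: nat
  have Rl: "filterlim R (at_left 1) sequentially"
    unfolding R_def[abs_def] by (intro filterlim_radius_at_left) simp
  then have Rlim: "R \<longlonglongrightarrow> 1" by (simp add: filterlim_at)
  have R: "0 < R n" "R n < 1" for n by (auto simp: R_def field_simps)
  define u where "u n = (\<lambda>t. Re (h (of_real (R n) * cis t)))" for n
  have cu: "continuous_on S (u n)" for n S
    unfolding u_def using R[of n] by (intro continuous_on_Re_circle) auto
  have u0: "0 \<le> u n t" for n t unfolding u_def using R[of n] by (intro less_imp_le pos) (simp add: norm_mult)
  define f where "f n t = integral {a..t} (u n)" for n t
  have f_diff: "f n t - f n s = integral {s..t} (u n)" if "a \<le> s" "s \<le> t" for n s t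
    using Henstock_Kurzweil_Integration.integral_combine[OF that integrable_continuous_real[OF cu], of n] by (simp add: f_def)
  define C where "C = 16 * pi * Re (h 0)"
  have A: "0 < Re (h 0)" by (intro pos) simp
  then have C0: "0 < C" by (simp add: C_def)
  have f_mono: "f n s \<le> f n t" if "a \<le> s" "s \<le> t" for n s t
    using f_diff[OF that, of n] integral_nonneg[OF integrable_continuous_real[OF cu], of s t n] u0 by simp
  have f_hoelder: "f n t - f n s \<le> C * (t - s) powr (1 - D)" if "a \<le> s" "s \<le> t" "t \<le> b" for n s t
    using f_diff[OF that(1,2), of n] integral_Re_hoelder[OF R, of s t n] that ab by (simp add: u_def C_def)
  have f_abs: "\<bar>f n x - f n y\<bar> \<le> C * \<bar>x - y\<bar> powr (1 - D)" if "x \<in> {a..b}" "y \<in> {a..b}" for n x y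
    using f_hoelder[of x y n] f_hoelder[of y x n] f_mono[of x y n] f_mono[of y x n] that
    by (cases "x \<le> y") (auto simp: abs_if)
  have fa: "f n a = 0" for n by (simp add: f_def)
  \<comment> \<open>The functions \<open>f n\<close> vanish at \<open>a\<close> and share one
    Hoelder bound, so they are bounded and equicontinuous on \<open>[a, b]\<close>, and a
    subsequence converges uniformly.\<close>
  obtain g k where g: "continuous_on {a..b} g" and k: "strict_mono (k :: nat \<Rightarrow> nat)"
    and lim: "\<And>e. 0 < e \<Longrightarrow> \<exists>N. \<forall>n x. n \<ge> N \<and> x \<in> {a..b} \<longrightarrow> norm (f (k n) x - g x) < e"
  proof (rule Arzela_Ascoli[of "{a..b}" f C])
    show "norm (f n x) \<le> C" if "x \<in> {a..b}" for n x
    proof -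
      have "\<bar>f n x - f n a\<bar> \<le> C * \<bar>x - a\<bar> powr (1 - D)" using that ab by (intro f_abs) auto
      also have "\<dots> \<le> C * 1" using that ab D C0 by (intro mult_left_mono powr_le1) auto
      finally show ?thesis by (simp add: fa)
    qed
    show "\<exists>d. 0 < d \<and> (\<forall>n y. y \<in> {a..b} \<and> norm (x - y) < d \<longrightarrow> norm (f n x - f n y) < e)"
      if x: "x \<in> {a..b}" and e: "0 < e" for x e
    proof (intro exI conjI allI impI)
      let ?d = "(e / C) powr (1 / (1 - D))"
      show "0 < ?d" using e C0 by simp
      fix n y assume y: "y \<in> {a..b} \<and> norm (x - y) < ?d"
      have "norm (f n x - f n y) \<le> C * \<bar>x - y\<bar> powr (1 - D)" using f_abs x y by simp
      also have "\<bar>x - y\<bar> powr (1 - D) < ?d powr (1 - D)" using y D by (intro powr_less_mono2) auto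
      also have "?d powr (1 - D) = e / C" using D e C0 by (simp add: powr_powr)
      finally show "norm (f n x - f n y) < e" using C0 by simp
    qed
  qed auto
  have fg: "(\<lambda>n. f (k n) x) \<longlonglongrightarrow> g x" if "x \<in> {a..b}" for x
    unfolding LIMSEQ_iff using lim that by meson
  have Rk: "(\<lambda>n. R (k n)) \<longlonglongrightarrow> 1"
    using LIMSEQ_subseq_LIMSEQ[OF Rlim k] by (simp add: o_def)
  have radial: "(\<lambda>n. Re (h (of_real (R (k n) * r) * cis x))) \<longlonglongrightarrow> Re (h (of_real r * cis x))"
    if "0 \<le> r" "r < 1" for r x
  proof -
    have "isCont h (of_real r * cis x)"
      using holomorphic_on_imp_continuous_on[OF hol] that
      by (auto simp: continuous_on_eq_continuous_at norm_mult)
    moreover have "(\<lambda>n. of_real (R (k n) * r) * cis x) \<longlonglongrightarrow> of_real (1 * r) * cis x"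
      by (intro tendsto_intros Rk)
    ultimately show ?thesis by (intro tendsto_Re isCont_tendsto_compose[of _ h]) auto
  qed
  \<comment> \<open>Clamping the argument to \<open>[a, b]\<close> extends \<open>g\<close> by
    constants to the whole line, where \<open>interval_measure\<close> is defined, and preserves the
    Hoelder bound.\<close>
  define F where "F t = g (max a (min b t))" for t
  have cl: "max a (min b t) \<in> {a..b}" for t using ab by auto
  have Fg: "F t = g t" if "t \<in> {a..b}" for t using that by (simp add: F_def min_absorb2 max_absorb2)
  have F1: "F s \<le> F t" if "s \<le> t" for s t
    unfolding F_def using that ab
    by (intro LIMSEQ_le[OF fg[OF cl] fg[OF cl]] exI[of _ 0] allI impI f_mono) auto
  have F2: "F t - F s \<le> C * (t - s) powr (1 - D)" if "s \<le> t" for s t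
  proof -
    let ?s = "max a (min b s)" and ?t = "max a (min b t)"
    have "F t - F s \<le> C * (?t - ?s) powr (1 - D)"
      unfolding F_def using that ab
      by (intro LIMSEQ_le_const2[OF tendsto_diff[OF fg[OF cl] fg[OF cl]]] exI[of _ 0] allI impI f_hoelder) auto
    also have "\<dots> \<le> C * (t - s) powr (1 - D)"
      using that ab D C0 by (intro mult_left_mono powr_mono2) auto
    finally show ?thesis .
  qed
  have F3: "F (x + d) - F (x - d) \<le> 8 * pi * d * Re (h (of_real (1 - d) * cis x))"
    if "0 < d" "a \<le> x - d" "x + d \<le> b" for x d
  proof -
    have d1: "d \<le> 1" using that ab by auto
    have "f (k n) (x + d) - f (k n) (x - d) \<le> 8 * pi * d * Re (h (of_real (R (k n) * (1 - d)) * cis x))" for n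
      using f_diff[of "x - d" "x + d" "k n"] that
        integral_Re_le_harmonic[OF hol less_imp_le[OF pos] R(1)[of "k n"] R(2)[of "k n"] that(1) d1, of x]
      by (simp add: u_def)
    moreover have "(\<lambda>n. f (k n) (x + d) - f (k n) (x - d)) \<longlonglongrightarrow> F (x + d) - F (x - d)"
      using that by (subst (1 2) Fg) (auto intro!: tendsto_diff fg)
    moreover have "(\<lambda>n. 8 * pi * d * Re (h (of_real (R (k n) * (1 - d)) * cis x))) \<longlonglongrightarrow>
        8 * pi * d * Re (h (of_real (1 - d) * cis x))"
      using that d1 by (intro tendsto_mult_left radial) auto
    ultimately show ?thesis by (meson LIMSEQ_le)
  qed
  \<comment> \<open>With no mass on \<open>[a, b]\<close>, \<open>Re_le_outside_arc\<close> gives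
    decay of order \<open>1 - r\<close> along the radius to the midpoint, whereas
    \<open>growth_lower\<close> permits no faster decay than \<open>(1 - r) powr D\<close> up to a
    constant, and \<open>D < 1\<close>.\<close>
  have F4: "F a < F b"
  proof (rule ccontr)
    assume "\<not> F a < F b"
    then have eq: "g b - g a = 0" using F1[of a b] ab Fg by auto
    define x where "x = (a + b) / 2"
    define l where "l = (b - a) / 2"
    have l: "0 < l" "l \<le> 1" "x - l = a" "x + l = b" using ab by (auto simp: x_def l_def field_simps)
    define c where "c = sin (l / 2)"
    have c: "0 < c" "c \<le> 1" unfolding c_def using l pi_gt3 by (auto intro!: sin_gt_zero)
    have up: "Re (h (of_real r * cis x)) \<le> (1 - r\<^sup>2) / c\<^sup>2 * Re (h 0)"
      if r: "1 - c \<le> r" "0 \<le> r" "r < 1" for r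
    proof -
      have "2 * pi * Re (h (of_real (R (k n) * r) * cis x)) \<le>
         (1 - r\<^sup>2) / c\<^sup>2 * (2 * pi * Re (h 0)) + (1 - r\<^sup>2) / (1 - r)\<^sup>2 * (f (k n) b - f (k n) a)" for n
        using Re_le_outside_arc[OF R(1)[of "k n"] R(2)[of "k n"] l(1,2) _ r(2,3), of x] r(1) f_diff[of a b "k n"] ab l(3,4)
        by (simp add: c_def u_def)
      moreover have "(\<lambda>n. 2 * pi * Re (h (of_real (R (k n) * r) * cis x))) \<longlonglongrightarrow> 2 * pi * Re (h (of_real r * cis x))"
        using r by (intro tendsto_mult_left radial)
      moreover have "(\<lambda>n. (1 - r\<^sup>2) / c\<^sup>2 * (2 * pi * Re (h 0)) + (1 - r\<^sup>2) / (1 - r)\<^sup>2 * (f (k n) b - f (k n) a))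
         \<longlonglongrightarrow> (1 - r\<^sup>2) / c\<^sup>2 * (2 * pi * Re (h 0)) + (1 - r\<^sup>2) / (1 - r)\<^sup>2 * (g b - g a)"
        using ab by (intro tendsto_intros fg) auto
      ultimately have "2 * pi * Re (h (of_real r * cis x)) \<le>
         (1 - r\<^sup>2) / c\<^sup>2 * (2 * pi * Re (h 0)) + (1 - r\<^sup>2) / (1 - r)\<^sup>2 * (g b - g a)"
        by (meson LIMSEQ_le)
      then have "2 * pi * Re (h (of_real r * cis x)) \<le> 2 * pi * ((1 - r\<^sup>2) / c\<^sup>2 * Re (h 0))"
        unfolding eq by (simp add: mult_ac)
      then show ?thesis by (simp only: mult_le_cancel_left_pos pi_gt_zero mult_pos_pos zero_less_numeral)
    qed
    \<comment> \<open>The radius will be \<open>1 - 2 * y\<close>. The first term of the minimum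
      keeps it at least \<open>1 - c\<close>; the second gives
      \<open>y powr (1 - D) \<le> c\<^sup>2 / 8\<close>, which turns
      \<open>y powr D \<le> 4 * y / c\<^sup>2\<close> into \<open>y \<le> y / 2\<close>.\<close>
    define y where "y = min (c / 2) ((c\<^sup>2 / 8) powr (1 / (1 - D)))"
    have y: "0 < y" "y \<le> c / 2" using c by (auto simp: y_def)
    have "y powr (1 - D) \<le> ((c\<^sup>2 / 8) powr (1 / (1 - D))) powr (1 - D)"
      using y D by (intro powr_mono2) (auto simp: y_def)
    also have "\<dots> = c\<^sup>2 / 8" using c D by (simp add: powr_powr)
    finally have y8: "y powr (1 - D) \<le> c\<^sup>2 / 8" .
    let ?r = "1 - 2 * y"
    have r: "1 - c \<le> ?r" "0 \<le> ?r" "?r < 1" using y c by auto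
    have "y powr D \<le> ((1 - ?r) / (1 + ?r)) powr D"
      using y r D by (intro powr_mono2) (auto simp: field_simps)
    then have "Re (h 0) * y powr D \<le> Re (h 0) * ((1 - ?r) / (1 + ?r)) powr D" using A by simp
    also have "\<dots> \<le> Re (h (of_real ?r * cis x))" by (rule growth_lower[OF r(2,3)])
    also have "\<dots> \<le> (1 - ?r\<^sup>2) / c\<^sup>2 * Re (h 0)" by (rule up[OF r])
    also have "\<dots> \<le> 4 * y / c\<^sup>2 * Re (h 0)"
      using A by (intro mult_right_mono divide_right_mono) (auto simp: power2_eq_square algebra_simps)
    finally have "y powr D \<le> 4 * y / c\<^sup>2" using A by (simp only: mult.commute[of _ "Re (h 0)"] mult_le_cancel_left_pos)
    then have "y powr D * y powr (1 - D) \<le> 4 * y / c\<^sup>2 * (c\<^sup>2 / 8)"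
      using y8 y by (intro mult_mono) auto
    also have "y powr D * y powr (1 - D) = y" using y by (simp add: powr_add[symmetric])
    also have "4 * y / c\<^sup>2 * (c\<^sup>2 / 8) = y / 2" using c by simp
    finally show False using y by simp
  qed
  have "continuous_on UNIV F"
    unfolding F_def by (rule continuous_on_compose2[OF g]) (use cl in \<open>auto intro!: continuous_intros\<close>)
  moreover have "mono F" using F1 by (rule monoI)
  ultimately show thesis using that[of F C] F2 F3 F4 C0 by simp
qed

end

section \<open>Differentiation of interval measures\<close>

text \<open>Among intervals with a common point, the one reaching furthest left and the one reaching
  furthest right cover all the others. A subfamily of least cardinality with the same union
  therefore covers no point three times.\<close>

lemma minimal_interval_cover:
  fixes \<J> :: "(real \<times> real) set"
  assumes "finite \<J>"
  obtains \<K> where "\<K> \<subseteq> \<J>" "(\<Union>(p,q)\<in>\<K>. {p<..<q}) = (\<Union>(p,q)\<in>\<J>. {p<..<q})"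
    "\<And>x. card {J\<in>\<K>. x \<in> {fst J<..<snd J}} \<le> 2"
proof -
  let ?U = "\<lambda>\<K>. \<Union>(p,q)\<in>\<K>. {p<..<q::real}"
  have "\<exists>\<K>. \<K> \<subseteq> \<J> \<and> ?U \<K> = ?U \<J> \<and> (\<forall>\<L>. \<L> \<subset> \<K> \<longrightarrow> ?U \<L> \<noteq> ?U \<J>)"
  proof -
    define P where "P = (\<lambda>\<K>. \<K> \<subseteq> \<J> \<and> ?U \<K> = ?U \<J>)"
    have "P \<J>" by (simp add: P_def)
    then obtain \<K> where K: "P \<K>" "\<And>\<L>. P \<L> \<Longrightarrow> card \<K> \<le> card \<L>"
      using ex_has_least_nat[of P \<J> card] by blast
    have "finite \<K>" using K(1) assms finite_subset by (auto simp: P_def)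
    then have "?U \<L> \<noteq> ?U \<J>" if "\<L> \<subset> \<K>" for \<L>
      using psubset_card_mono[OF _ that] K(2)[of \<L>] K(1) that unfolding P_def by (meson leD psubset_imp_subset subset_trans)
    then show ?thesis using K(1) unfolding P_def by blast
  qed
  then obtain \<K> where K: "\<K> \<subseteq> \<J>" "?U \<K> = ?U \<J>" and min: "\<And>\<L>. \<L> \<subset> \<K> \<Longrightarrow> ?U \<L> \<noteq> ?U \<J>"
    by blast
  have fin: "finite \<K>" using K(1) assms finite_subset by blast
  have "card {J\<in>\<K>. x \<in> {fst J<..<snd J}} \<le> 2" (is "card ?A \<le> 2") for x
  proof (cases "?A = {}")
    case False
    have fA: "finite ?A" using fin by simp
    obtain L where L: "L \<in> ?A" "\<And>J. J \<in> ?A \<Longrightarrow> fst L \<le> fst J"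
      using ex_is_arg_min_if_finite[OF fA False, of fst] unfolding is_arg_min_linorder by blast
    obtain M where M: "M \<in> ?A" "\<And>J. J \<in> ?A \<Longrightarrow> snd J \<le> snd M"
      using ex_is_arg_min_if_finite[OF fA False, of "\<lambda>J. - snd J"] unfolding is_arg_min_linorder neg_le_iff_le by blast
    have "?A \<subseteq> {L, M}"
    proof
      fix J assume J: "J \<in> ?A"
      show "J \<in> {L, M}"
      proof (rule ccontr)
        assume n: "J \<notin> {L, M}"
        have "{fst J<..<snd J} \<subseteq> {fst L<..<snd L} \<union> {fst M<..<snd M}"
          using L(1) M(1) L(2)[OF J] M(2)[OF J] by auto
        then have "?U \<K> \<subseteq> ?U (\<K> - {J})"
        proof -
          have "{fst I<..<snd I} \<subseteq> ?U (\<K> - {J})" if "I \<in> \<K>" "I \<noteq> J" for I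
            using that by (auto simp: split_beta)
          moreover have "L \<in> \<K>" "M \<in> \<K>" "L \<noteq> J" "M \<noteq> J" using L(1) M(1) n by auto
          ultimately have "{fst I<..<snd I} \<subseteq> ?U (\<K> - {J})" if "I \<in> \<K>" for I
            using \<open>{fst J<..<snd J} \<subseteq> _\<close> that by (cases "I = J") (blast, blast)
          then show ?thesis by (auto simp: split_beta)
        qed
        moreover have "?U (\<K> - {J}) \<subseteq> ?U \<K>" by (intro UN_mono) auto
        ultimately have "?U (\<K> - {J}) = ?U \<J>" using K(2) by (metis subset_antisym)
        moreover have "\<K> - {J} \<subset> \<K>" using J by auto
        ultimately show False using min by blast
      qed
    qed
    then have "card ?A \<le> card {L, M}" by (intro card_mono) auto
    also have "\<dots> \<le> 2" by (simp add: card_insert_if)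
    finally show ?thesis .
  next
    case True
    then show ?thesis by (simp only: card.empty)
  qed
  then show thesis using that[OF K] by blast
qed

text \<open>The sum of the indicators counts the sets through a point, so it is at most
  \<open>n\<close> times the indicator of \<open>U\<close>.\<close>

lemma sum_emeasure_le_overlap:
  fixes A :: "'i \<Rightarrow> 'a set"
  assumes "finite I" and "\<And>i. i \<in> I \<Longrightarrow> A i \<in> sets M" and "U \<in> sets M" and "\<And>i. i \<in> I \<Longrightarrow> A i \<subseteq> U"
    and "\<And>x. card {i\<in>I. x \<in> A i} \<le> n"
  shows "(\<Sum>i\<in>I. emeasure M (A i)) \<le> of_nat n * emeasure M U"
proof -
  have "(\<Sum>i\<in>I. emeasure M (A i)) = (\<Sum>i\<in>I. \<integral>\<^sup>+x. indicator (A i) x \<partial>M)"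
    using assms by (intro sum.cong) auto
  also have "\<dots> = (\<integral>\<^sup>+x. (\<Sum>i\<in>I. indicator (A i) x) \<partial>M)"
    using assms by (intro nn_integral_sum[symmetric]) auto
  also have "\<dots> \<le> (\<integral>\<^sup>+x. of_nat n * indicator U x \<partial>M)"
  proof (rule nn_integral_mono)
    fix x
    have "(\<Sum>i\<in>I. indicator (A i) x) = (of_nat (card {i\<in>I. x \<in> A i}) :: ennreal)"
      using assms(1) by (simp add: indicator_def sum.If_cases Int_def)
    also have "\<dots> \<le> of_nat n * indicator U x"
    proof (cases "x \<in> U")
      case False
      then have "{i\<in>I. x \<in> A i} = {}" using assms(4) by auto
      then show ?thesis using False by (simp only: card.empty) simp
    qed (use assms(5)[of x] in simp)
    finally show "(\<Sum>i\<in>I. indicator (A i) x) \<le> (of_nat n * indicator U x :: ennreal)" .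
  qed
  also have "\<dots> = of_nat n * emeasure M U" using assms(3) by (simp add: nn_integral_cmult)
  finally show ?thesis .
qed

text \<open>Each point of \<open>A\<close> gets a symmetric interval inside \<open>U\<close> whose
  mass is at most \<open>t / 2\<close> times its length. Thinning finite families to overlap at most
  2 bounds the mass of their union by \<open>t\<close> times the Lebesgue measure of
  \<open>U\<close>, independently of the family.\<close>

lemma interval_measure_cover_le:
  fixes F :: "real \<Rightarrow> real"
  assumes mono: "mono F" and cont: "continuous_on UNIV F" and t: "0 \<le> t"
    and U: "open U" "A \<subseteq> U"
    and A: "\<And>x e. x \<in> A \<Longrightarrow> 0 < e \<Longrightarrow> \<exists>d>0. d < e \<and> F (x + d) - F (x - d) \<le> t * d"
  obtains G where "open G" "A \<subseteq> G" "emeasure (interval_measure F) G \<le> ennreal t * emeasure lborel U"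
proof -
  let ?M = "interval_measure F"
  have Ioo: "emeasure ?M {p<..<q} \<le> ennreal (F q - F p)" if "p \<le> q" for p q
  proof -
    have "emeasure ?M {p<..<q} \<le> emeasure ?M {p..q}" by (intro emeasure_mono) auto
    also have "\<dots> = ennreal (F q - F p)"
      using that mono cont by (intro emeasure_interval_measure_Icc) (auto dest: monoD)
    finally show ?thesis .
  qed
  have "\<exists>d>0. {x - d<..<x + d} \<subseteq> U \<and> F (x + d) - F (x - d) \<le> t * d" if x: "x \<in> A" for x
  proof -
    obtain e where "e > 0" "ball x e \<subseteq> U" using U x open_contains_ball by blast
    with A[OF x \<open>e > 0\<close>] show ?thesis by (force simp: subset_iff dist_real_def)
  qed
  then obtain d where d: "\<And>x. x \<in> A \<Longrightarrow> d x > 0" "\<And>x. x \<in> A \<Longrightarrow> {x - d x<..<x + d x} \<subseteq> U"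
     "\<And>x. x \<in> A \<Longrightarrow> F (x + d x) - F (x - d x) \<le> t * d x" by metis
  define G where "G = (\<Union>x\<in>A. {x - d x<..<x + d x})"
  have fin: "emeasure ?M (\<Union>x\<in>B. {x - d x<..<x + d x}) \<le> ennreal t * emeasure lborel U"
    if B: "finite B" "B \<subseteq> A" for B
  proof -
    define \<J> where "\<J> = (\<lambda>x. (x - d x, x + d x)) ` B"
    have "finite \<J>" using B by (simp add: \<J>_def)
    then obtain \<K> where K: "\<K> \<subseteq> \<J>" "(\<Union>(p,q)\<in>\<K>. {p<..<q}) = (\<Union>(p,q)\<in>\<J>. {p<..<q})"
      "\<And>x. card {J\<in>\<K>. x \<in> {fst J<..<snd J}} \<le> 2" using minimal_interval_cover by blast
    have fK: "finite \<K>" using K(1) \<open>finite \<J>\<close> finite_subset by blast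
    have J: "fst J \<le> snd J \<and> {fst J<..<snd J} \<subseteq> U \<and> F (snd J) - F (fst J) \<le> t / 2 * (snd J - fst J)"
      if JK: "J \<in> \<K>" for J
    proof -
      obtain x where "x \<in> A" "J = (x - d x, x + d x)" using subsetD[OF K(1) JK] B(2) by (auto simp: \<J>_def)
      then show ?thesis using d(1)[of x] d(2)[of x] d(3)[of x] by simp
    qed
    have "(\<Union>x\<in>B. {x - d x<..<x + d x}) = (\<Union>J\<in>\<K>. {fst J<..<snd J})"
      using K(2) by (auto simp: \<J>_def split_beta)
    then have "emeasure ?M (\<Union>x\<in>B. {x - d x<..<x + d x}) \<le> (\<Sum>J\<in>\<K>. emeasure ?M {fst J<..<snd J})"
      using fK by (simp add: emeasure_subadditive_finite image_subset_iff)
    also have "\<dots> \<le> (\<Sum>J\<in>\<K>. ennreal (t / 2) * emeasure lborel {fst J<..<snd J})"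
    proof (rule sum_mono)
      fix J assume "J \<in> \<K>"
      note J = J[OF this]
      have "emeasure ?M {fst J<..<snd J} \<le> ennreal (F (snd J) - F (fst J))" using J Ioo by blast
      also have "\<dots> \<le> ennreal (t / 2 * (snd J - fst J))" using J by (intro ennreal_leI) auto
      also have "\<dots> = ennreal (t / 2) * emeasure lborel {fst J<..<snd J}"
        using J t by (simp only: emeasure_lborel_Ioo) (simp only: ennreal_mult[symmetric] divide_nonneg_nonneg zero_le_numeral diff_ge_0_iff_ge)
      finally show "emeasure ?M {fst J<..<snd J} \<le> ennreal (t / 2) * emeasure lborel {fst J<..<snd J}" .
    qed
    also have "\<dots> = ennreal (t / 2) * (\<Sum>J\<in>\<K>. emeasure lborel {fst J<..<snd J})"
      by (simp add: sum_distrib_left)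
    also have "\<dots> \<le> ennreal (t / 2) * (of_nat 2 * emeasure lborel U)"
      by (intro mult_left_mono sum_emeasure_le_overlap fK K(3)) (use U J in auto)
    also have "\<dots> = ennreal t * emeasure lborel U"
    proof -
      have "ennreal (t / 2) * of_nat 2 = ennreal (t / 2 * 2)" using t by (subst ennreal_mult) auto
      then show ?thesis by (simp add: mult.assoc[symmetric])
    qed
    finally show ?thesis .
  qed
  \<comment> \<open>Lindelof's theorem reduces \<open>G\<close> to countably many intervals. Finite
    unions, to which \<open>fin\<close> applies, exhaust them, and continuity of the measure from
    below gives the bound for \<open>G\<close>.\<close>
  have op: "open S" if "S \<in> (\<lambda>x. {x - d x<..<x + d x}) ` A" for S using that by auto
  obtain \<D> where D: "\<D> \<subseteq> (\<lambda>x. {x - d x<..<x + d x}) ` A" "countable \<D>" "\<Union>\<D> = G"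
    unfolding G_def using op by (rule Lindelof)
  obtain C where C: "C \<subseteq> A" "countable C" "\<D> = (\<lambda>x. {x - d x<..<x + d x}) ` C"
    using countable_subset_image[THEN iffD1, OF conjI[OF D(2,1)]] by (elim exE conjE)
  have "emeasure ?M G \<le> ennreal t * emeasure lborel U"
  proof (cases "C = {}")
    case True
    then show ?thesis using D(3) C(3) by auto
  next
    case False
    define c where "c = from_nat_into C"
    have rc: "range c = C" using False C(2) by (simp add: c_def range_from_nat_into)
    define H where "H n = (\<Union>x\<in>c ` {..n}. {x - d x<..<x + d x})" for n
    have oH: "H n \<in> sets borel" for n unfolding H_def by (intro borel_open open_UN) auto
    have "incseq H" unfolding H_def by (intro monoI UN_mono image_mono) auto
    moreover have "(\<Union>n. H n) = G" using D(3) C(3) rc by (fastforce simp: H_def)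
    ultimately have "(SUP n. emeasure ?M (H n)) = emeasure ?M G"
      using SUP_emeasure_incseq[of H ?M] oH by (simp add: image_subset_iff)
    moreover have "emeasure ?M (H n) \<le> ennreal t * emeasure lborel U" for n
      unfolding H_def using rc C(1) by (intro fin) auto
    ultimately show ?thesis by (metis SUP_least)
  qed
  moreover have "open G" unfolding G_def by auto
  moreover have "A \<subseteq> G" unfolding G_def using d(1) by force
  ultimately show thesis using that by blast
qed

text \<open>The intersection of covers of measure at most \<open>1 / (n + 1)\<close> is a null set.
  A null superset stands in for measure 0, since \<open>A\<close> itself may fail to be
  measurable.\<close>

lemma ex_null_superset:
  assumes "\<And>e::real. 0 < e \<Longrightarrow> \<exists>G\<in>sets M. A \<subseteq> G \<and> emeasure M G \<le> ennreal e"
  shows "\<exists>B\<in>null_sets M. A \<subseteq> B"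
proof -
  have "\<exists>G. \<forall>n. G n \<in> sets M \<and> A \<subseteq> G n \<and> emeasure M (G n) \<le> ennreal (1 / real (Suc n))"
    by (intro choice allI) (use assms[of "1 / real (Suc _)"] in \<open>simp add: Bex_def\<close>)
  then obtain G where G: "\<And>n. G n \<in> sets M" "\<And>n. A \<subseteq> G n" "\<And>n. emeasure M (G n) \<le> ennreal (1 / real (Suc n))"
    by blast
  have "emeasure M (\<Inter>n. G n) \<le> 0"
  proof (rule LIMSEQ_le_const)
    show "(\<lambda>n. ennreal (1 / real (Suc n))) \<longlonglongrightarrow> 0"
      using tendsto_ennrealI[OF LIMSEQ_inverse_real_of_nat] by (simp add: inverse_eq_divide)
    have "emeasure M (\<Inter>n. G n) \<le> ennreal (1 / real (Suc n))" for n
      using emeasure_mono[of "\<Inter>n. G n" "G n" M] G by (meson INT_lower UNIV_I order_trans)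
    then show "\<exists>N. \<forall>n\<ge>N. emeasure M (\<Inter>n. G n) \<le> ennreal (1 / real (Suc n))" by blast
  qed
  then have "(\<Inter>n. G n) \<in> null_sets M" using G(1) by (intro null_setsI) auto
  then show ?thesis using G(2) by blast
qed

text \<open>A differentiation argument. Off \<open>N\<close> the lower symmetric derivative of
  \<open>F\<close> is 0, so open covers built inside \<open>{a<..<b}\<close> have arbitrarily small
  mass. On \<open>N\<close> it is only finite, but \<open>N\<close> lies in open sets of arbitrarily
  small Lebesgue measure, which compensates any fixed bound \<open>n\<close>.\<close>

lemma interval_measure_null:
  fixes F :: "real \<Rightarrow> real"
  assumes F: "mono F" "continuous_on UNIV F" and N: "N \<in> null_sets lborel" and A: "A \<subseteq> {a<..<b}"
    and zero: "\<And>x c e. x \<in> A - N \<Longrightarrow> 0 < c \<Longrightarrow> 0 < e \<Longrightarrow> \<exists>d>0. d < e \<and> F (x + d) - F (x - d) \<le> c * d"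
    and fin: "\<And>x. x \<in> A \<Longrightarrow> \<exists>n::nat. \<forall>e>0. \<exists>d>0. d < e \<and> F (x + d) - F (x - d) \<le> real n * d"
  shows "\<exists>B\<in>null_sets (interval_measure F). A \<subseteq> B"
proof -
  let ?M = "interval_measure F"
  \<comment> \<open>The bound on the lower derivative may fail to be uniform on \<open>N\<close>;
    \<open>A' n\<close> collects the points where \<open>n\<close> serves, and the countable union
    is harmless.\<close>
  define A' where "A' n = {x \<in> A \<inter> N. \<forall>e>0. \<exists>d>0. d < e \<and> F (x + d) - F (x - d) \<le> real n * d}" for n :: nat
  have "\<exists>B\<in>null_sets ?M. A - N \<subseteq> B"
  proof (rule ex_null_superset)
    fix e :: real assume e: "0 < e"
    define l where "l = \<bar>b - a\<bar> + 1"
    have l: "0 < l" by (simp add: l_def)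
    obtain G where G: "open G" "A - N \<subseteq> G" "emeasure ?M G \<le> ennreal (e / l) * emeasure lborel {a<..<b}"
    proof (rule interval_measure_cover_le[OF F])
      show "0 \<le> e / l" using e l by simp
      show "open {a<..<b}" by simp
      show "A - N \<subseteq> {a<..<b}" using A by auto
      show "\<exists>d>0. d < \<epsilon> \<and> F (x + d) - F (x - d) \<le> e / l * d" if "x \<in> A - N" "0 < \<epsilon>" for x \<epsilon>
        using zero[OF that(1) _ that(2), of "e / l"] e l by simp
    qed
    have "emeasure lborel {a<..<b} \<le> ennreal l"
      by (cases "a \<le> b") (auto simp: l_def intro!: ennreal_leI)
    then have "ennreal (e / l) * emeasure lborel {a<..<b} \<le> ennreal (e / l) * ennreal l"
      by (intro mult_left_mono) auto
    also have "\<dots> = ennreal e" using e l by (simp add: ennreal_mult[symmetric])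
    finally show "\<exists>G\<in>sets ?M. A - N \<subseteq> G \<and> emeasure ?M G \<le> ennreal e" using G by (auto intro!: bexI[of _ G])
  qed
  then obtain B0 where B0: "B0 \<in> null_sets ?M" "A - N \<subseteq> B0" by blast
  have "\<exists>B\<in>null_sets ?M. A' n \<subseteq> B" for n
  proof (rule ex_null_superset)
    fix e :: real assume e: "0 < e"
    have "N \<in> sets borel" using N by auto
    \<comment> \<open>Dividing by \<open>real n + 1\<close> instead of \<open>real n\<close>
      includes \<open>n = 0\<close>.\<close>
    then obtain U where U: "open U" "N \<subseteq> U" "emeasure lborel (U - N) < ennreal (e / (real n + 1))"
      using outer_regular_lborel[of N "e / (real n + 1)"] e by auto
    have "emeasure lborel U = emeasure lborel (U - N)"
      using N U(1) by (intro emeasure_Diff_null_set[symmetric]) auto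
    then have lU: "emeasure lborel U \<le> ennreal (e / (real n + 1))" using U(3) by simp
    obtain G where G: "open G" "A' n \<subseteq> G" "emeasure ?M G \<le> ennreal (real n) * emeasure lborel U"
    proof (rule interval_measure_cover_le[OF F, where t = "real n"])
      show "A' n \<subseteq> U" using U(2) by (auto simp: A'_def)
    qed (use U(1) in \<open>auto simp: A'_def\<close>)
    note G(3)
    also have "ennreal (real n) * emeasure lborel U \<le> ennreal (real n) * ennreal (e / (real n + 1))"
      using lU by (intro mult_left_mono) auto
    also have "\<dots> = ennreal (real n * (e / (real n + 1)))" using e by (intro ennreal_mult[symmetric]) auto
    also have "\<dots> \<le> ennreal e" using e by (intro ennreal_leI) (simp add: field_simps)
    finally show "\<exists>G\<in>sets ?M. A' n \<subseteq> G \<and> emeasure ?M G \<le> ennreal e" using G by (auto intro!: bexI[of _ G])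
  qed
  then obtain B where B: "\<And>n. B n \<in> null_sets ?M" "\<And>n. A' n \<subseteq> B n" by metis
  have "B0 \<union> (\<Union>n. B n) \<in> null_sets ?M" using B0 B by (intro null_sets.Un null_sets_UN) auto
  moreover have "A \<subseteq> B0 \<union> (\<Union>n. B n)"
  proof
    fix x assume x: "x \<in> A"
    show "x \<in> B0 \<union> (\<Union>n. B n)"
    proof (cases "x \<in> N")
      case True
      with fin[OF x] x obtain n where "x \<in> A' n" by (auto simp: A'_def)
      then show ?thesis using B(2) by blast
    qed (use x B0 in auto)
  qed
  ultimately show ?thesis by blast
qed

section \<open>The mass distribution principle\<close>

lemma cis_eq_imp_shift:
  assumes "cis s = cis t"
  obtains m :: int where "s = t + 2 * pi * of_int m"
proof -
  have "exp (\<i> * of_real s) = exp (\<i> * of_real t)" using assms by (simp add: cis_conv_exp)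
  then obtain n :: int where "\<i> * of_real s = \<i> * of_real t + (of_int (2 * n) * pi) * \<i>"
    unfolding exp_eq by blast
  then have "s = t + 2 * pi * of_int n" by (auto simp: complex_eq_iff mult_ac)
  then show thesis by (rule that)
qed

text \<open>The part of \<open>[a, b]\<close> that an arc of length \<open>l\<close> covers has mass
  at most \<open>2 * C * l powr s\<close>, so any arcs covering \<open>E\<close> have total content
  at least a fixed multiple of \<open>F b - F a\<close>. The null set \<open>B\<close> may be missed
  without loss of mass.\<close>

lemma hcontent_pos:
  fixes F :: "real \<Rightarrow> real"
  assumes F: "mono F" "continuous_on UNIV F" and ab: "b \<le> a + 1" "F a < F b" and s: "0 < s" and C: "0 \<le> C"
    and hoelder: "\<And>p q. p \<le> q \<Longrightarrow> F q - F p \<le> C * (q - p) powr s"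
    and B: "B \<in> null_sets (interval_measure F)" and E: "\<And>t. t \<in> {a<..<b} - B \<Longrightarrow> cis t \<in> E"
  shows "0 < hcontent s E"
proof -
  let ?M = "interval_measure F"
  have Icc: "emeasure ?M {p..q} = ennreal (F q - F p)" if "p \<le> q" for p q
    using that F by (intro emeasure_interval_measure_Icc) (auto dest: monoD)
  have ab': "a < b" using ab(2) F(1) by (meson leI monoD not_le)
  \<comment> \<open>The factor 2 accounts for two translates of each lifted arc,
    \<open>(2 * pi) powr s\<close> for the normalized arc length, and the added 1 keeps
    \<open>K\<close> positive when \<open>C = 0\<close>.\<close>
  define K where "K = 2 * C * (2 * pi) powr s + 1"
  have K: "0 < K" using C by (simp add: K_def add_nonneg_pos)
  have main: "ennreal (F b - F a) \<le> ennreal K * (\<Sum>j. ennreal (((snd (ab j) - fst (ab j)) / (2*pi)) powr s))"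
    if cov: "\<forall>j. fst (ab j) \<le> snd (ab j) \<and> snd (ab j) - fst (ab j) \<le> 2*pi"
        "E \<subseteq> (\<Union>j. arc (fst (ab j)) (snd (ab j)))" for ab :: "nat \<Rightarrow> real \<times> real"
  proof -
    define l where "l j = snd (ab j) - fst (ab j)" for j
    have l: "0 \<le> l j" "l j \<le> 2 * pi" for j using cov(1) by (auto simp: l_def)
    \<comment> \<open>Shift the lift of each arc to start in \<open>[a - 2\<pi>, a)\<close>; only it and its next translate can meet \<open>[a, b]\<close>.\<close>
    define k where "k j = \<lfloor>(fst (ab j) - a) / (2 * pi)\<rfloor> + 1" for j
    define c where "c j = fst (ab j) - 2 * pi * of_int (k j)" for j
    have c: "a - 2 * pi \<le> c j" "c j < a" for j
    proof -
      let ?y = "(fst (ab j) - a) / (2 * pi)"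
      have "2 * pi * of_int \<lfloor>?y\<rfloor> \<le> 2 * pi * ?y" "2 * pi * ?y < 2 * pi * (of_int \<lfloor>?y\<rfloor> + 1)"
        by (intro mult_left_mono mult_strict_left_mono; use floor_correct[of ?y] in simp)+
      moreover have "2 * pi * ?y = fst (ab j) - a" by simp
      ultimately have "2 * pi * of_int \<lfloor>?y\<rfloor> \<le> fst (ab j) - a" "fst (ab j) - a < 2 * pi * (of_int \<lfloor>?y\<rfloor> + 1)"
        by (simp_all only:)
      then show "a - 2 * pi \<le> c j" "c j < a" by (simp_all add: c_def k_def algebra_simps)
    qed
    define J where "J j = {c j..c j + l j} \<union> {c j + 2 * pi..c j + 2 * pi + l j}" for j
    have MJ: "emeasure ?M (J j) \<le> ennreal K * ennreal ((l j / (2*pi)) powr s)" for j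
    proof -
      have "emeasure ?M (J j) \<le> ennreal (F (c j + l j) - F (c j)) + ennreal (F (c j + 2 * pi + l j) - F (c j + 2 * pi))"
        unfolding J_def using l[of j] by (subst (1 2) Icc[symmetric]) (auto intro!: emeasure_subadditive)
      also have "\<dots> \<le> ennreal (C * l j powr s) + ennreal (C * l j powr s)"
        using hoelder[of "c j" "c j + l j"] hoelder[of "c j + 2 * pi" "c j + 2 * pi + l j"] l[of j]
        by (intro add_mono ennreal_leI) auto
      also have "\<dots> = ennreal (2 * C * l j powr s)" using C by (simp flip: ennreal_plus)
      also have "2 * C * l j powr s = (K - 1) * (l j / (2*pi)) powr s"
        using l[of j] by (simp add: K_def powr_divide)
      also have "ennreal ((K - 1) * (l j / (2*pi)) powr s) \<le> ennreal (K * (l j / (2*pi)) powr s)"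
        by (intro ennreal_leI mult_right_mono) auto
      also have "\<dots> = ennreal K * ennreal ((l j / (2*pi)) powr s)" using K by (simp add: ennreal_mult)
      finally show ?thesis .
    qed
    \<comment> \<open>The hypothesis on \<open>E\<close> concerns the open interval only; the
      endpoints are added as single points, which have no mass since \<open>F\<close> is
      continuous.\<close>
    have sub: "{a..b} \<subseteq> (B \<union> {a..a} \<union> {b..b}) \<union> (\<Union>j. J j)"
    proof
      fix t assume t: "t \<in> {a..b}"
      show "t \<in> (B \<union> {a..a} \<union> {b..b}) \<union> (\<Union>j. J j)"
      proof (cases "t \<in> {a<..<b} - B")
        case True
        then obtain j where "cis t \<in> arc (fst (ab j)) (snd (ab j))" using E cov(2) by blast
        then obtain q where q: "cis t = cis q" "q \<in> {fst (ab j)..snd (ab j)}" by (auto simp: arc_def)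
        then obtain m where m: "t = q + 2 * pi * of_int m" using cis_eq_imp_shift by blast
        define i where "i = k j + m"
        have ti: "t = c j + (q - fst (ab j)) + 2 * pi * of_int i"
          by (simp add: c_def i_def m algebra_simps)
        have qq: "0 \<le> q - fst (ab j)" "q - fst (ab j) \<le> l j" using q(2) by (auto simp: l_def)
        \<comment> \<open>For \<open>i \<le> -1\<close> the point would lie left of
          \<open>a\<close>, because \<open>l j \<le> 2 * pi\<close> and \<open>c j < a\<close>; for
          \<open>i \<ge> 2\<close> it would lie at or beyond \<open>a + 2 * pi\<close>, hence right
          of \<open>b\<close>.\<close>
        have "0 < 2 * pi * (of_int i + 1)" using ti c[of j] t qq l[of j] by (simp add: algebra_simps)
        then have "-1 < i" by (simp add: zero_less_mult_iff)
        moreover have "2 * pi * of_int i < 2 * pi * 2"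
          using ti c[of j] t qq(1) ab(1) pi_gt3 unfolding atLeastAtMost_iff by linarith
        then have "i < 2" by simp
        ultimately have "i = 0 \<or> i = 1" by auto
        then have "t \<in> J j" using ti qq by (auto simp: J_def)
        then show ?thesis by blast
      qed (use t in auto)
    qed
    have null: "B \<union> {a..a} \<union> {b..b} \<in> null_sets ?M"
      using B Icc[of a a] Icc[of b b] by (intro null_sets.Un) (auto intro!: null_setsI)
    have J_sets: "range J \<subseteq> sets ?M" unfolding J_def by auto
    have "ennreal (F b - F a) = emeasure ?M {a..b}" using ab' by (simp add: Icc)
    also have "\<dots> \<le> emeasure ?M ((B \<union> {a..a} \<union> {b..b}) \<union> (\<Union>j. J j))"
      using sub null J_sets by (intro emeasure_mono sets.Un sets.countable_UN null_setsD2) auto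
    also have "\<dots> = emeasure ?M (\<Union>j. J j)"
      using emeasure_Un_null_set[of "\<Union>j. J j" ?M, OF _ null] J_sets by (simp add: Un_commute)
    also have "\<dots> \<le> (\<Sum>j. emeasure ?M (J j))" using J_sets by (rule emeasure_subadditive_countably)
    also have "\<dots> \<le> (\<Sum>j. ennreal K * ennreal ((l j / (2*pi)) powr s))"
      using MJ by (intro suminf_le) auto
    finally show ?thesis by (simp add: l_def)
  qed
  have "ennreal ((F b - F a) / K) \<le> hcontent s E"
    unfolding hcontent_def
  proof (rule INF_greatest)
    fix ab :: "nat \<Rightarrow> real \<times> real"
    let ?S = "\<Sum>j. ennreal (((snd (ab j) - fst (ab j)) / (2*pi)) powr s)"
    assume "ab \<in> {ab. (\<forall>j. fst (ab j) \<le> snd (ab j) \<and> snd (ab j) - fst (ab j) \<le> 2*pi) \<and>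
        E \<subseteq> (\<Union>j. arc (fst (ab j)) (snd (ab j)))}"
    then have "ennreal (F b - F a) \<le> ennreal K * ?S" by (intro main) auto
    then have "ennreal (1 / K) * ennreal (F b - F a) \<le> ennreal (1 / K) * (ennreal K * ?S)"
      by (intro mult_left_mono) auto
    also have "\<dots> = ?S" using K by (simp add: mult.assoc[symmetric] ennreal_mult[symmetric])
    also have "ennreal (1 / K) * ennreal (F b - F a) = ennreal ((F b - F a) / K)"
      using K ab(2) by (simp add: ennreal_mult[symmetric])
    finally show "ennreal ((F b - F a) / K) \<le> ?S" .
  qed
  moreover have "0 < ennreal ((F b - F a) / K)" using K ab(2) by simp
  ultimately show ?thesis by (rule less_le_trans[rotated])
qed

section \<open>The Cayley transform of an inner function\<close>

text \<open>The second identity makes the real part positive and shows that it tends to 0 as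
  \<open>w\<close> approaches the circle away from \<open>\<alpha>\<close>; the third converts the
  size of the transform into the distance of \<open>w\<close> from \<open>\<alpha>\<close>.\<close>

lemma cayley_norms:
  fixes \<alpha> w :: complex
  assumes \<alpha>: "cmod \<alpha> = 1" and w: "cmod w < 1"
  shows "\<alpha> - w \<noteq> 0"
    and "Re ((\<alpha> + w) / (\<alpha> - w)) = (1 - (cmod w)\<^sup>2) / (cmod (\<alpha> - w))\<^sup>2"
    and "cmod ((\<alpha> + w) / (\<alpha> - w) + 1) = 2 / cmod (\<alpha> - w)"
proof -
  show n: "\<alpha> - w \<noteq> 0" using assms by auto
  have "(Re \<alpha>)\<^sup>2 + (Im \<alpha>)\<^sup>2 = 1" using \<alpha> by (simp add: cmod_def)
  then show "Re ((\<alpha> + w) / (\<alpha> - w)) = (1 - (cmod w)\<^sup>2) / (cmod (\<alpha> - w))\<^sup>2"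
    unfolding Re_divide cmod_power2 by (simp add: power2_eq_square algebra_simps)
  have "(\<alpha> + w) / (\<alpha> - w) + 1 = 2 * \<alpha> / (\<alpha> - w)" using n by (simp add: field_simps)
  then show "cmod ((\<alpha> + w) / (\<alpha> - w) + 1) = 2 / cmod (\<alpha> - w)"
    using \<alpha> by (simp add: norm_divide norm_mult)
qed

text \<open>The transform has derivative
  \<open>2 * \<alpha> * deriv f z / (\<alpha> - f z)\<^sup>2\<close>. Dividing its modulus by the
  real part from \<open>cayley_norms\<close> cancels \<open>\<alpha> - f z\<close> and leaves
  \<open>2 * cmod (deriv f z) / (1 - (cmod (f z))\<^sup>2)\<close>.\<close>

lemma slow_growth_cayley:
  assumes f: "f holomorphic_on ball 0 1" and lt: "\<And>z. cmod z < 1 \<Longrightarrow> cmod (f z) < 1"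
    and \<alpha>: "cmod \<alpha> = 1" and D: "\<And>z. cmod z < 1 \<Longrightarrow> hyp_deriv f z \<le> D" "D < 1"
  shows "slow_growth (\<lambda>z. (\<alpha> + f z) / (\<alpha> - f z)) D"
proof
  show "(\<lambda>z. (\<alpha> + f z) / (\<alpha> - f z)) holomorphic_on ball 0 1"
    using cayley_norms(1)[OF \<alpha> lt] by (intro holomorphic_intros f) auto
  have lt2: "0 < 1 - (cmod (f z))\<^sup>2" if "cmod z < 1" for z
    using lt[OF that] by (simp add: power_less_one_iff abs_square_less_1)
  show "0 < Re ((\<alpha> + f z) / (\<alpha> - f z))" if "cmod z < 1" for z
    using cayley_norms[OF \<alpha> lt[OF that]] lt2[OF that] by simp
  show "(1 - (cmod z)\<^sup>2) * cmod (deriv (\<lambda>z. (\<alpha> + f z) / (\<alpha> - f z)) z) \<le> 2 * D * Re ((\<alpha> + f z) / (\<alpha> - f z))"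
    if z: "cmod z < 1" for z
  proof -
    note n = cayley_norms(1)[OF \<alpha> lt[OF z]]
    have "(f has_field_derivative deriv f z) (at z)" using z by (intro holomorphic_derivI[OF f]) auto
    then have "((\<lambda>z. (\<alpha> + f z) / (\<alpha> - f z)) has_field_derivative
        ((deriv f z * (\<alpha> - f z) - (\<alpha> + f z) * (- deriv f z)) / ((\<alpha> - f z) * (\<alpha> - f z)))) (at z)"
      using n by (intro DERIV_divide) (auto intro!: derivative_eq_intros)
    then have "deriv (\<lambda>z. (\<alpha> + f z) / (\<alpha> - f z)) z = 2 * \<alpha> * deriv f z / (\<alpha> - f z)\<^sup>2"
      by (subst DERIV_imp_deriv) (auto simp: power2_eq_square algebra_simps)
    then have d: "cmod (deriv (\<lambda>z. (\<alpha> + f z) / (\<alpha> - f z)) z) = 2 * cmod (deriv f z) / (cmod (\<alpha> - f z))\<^sup>2"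
      using \<alpha> by (simp add: norm_mult norm_divide norm_power)
    have "(1 - (cmod z)\<^sup>2) * cmod (deriv f z) \<le> D * (1 - (cmod (f z))\<^sup>2)"
      using D(1)[OF z] lt2[OF z] by (simp add: hyp_deriv_def field_simps)
    then have "2 * ((1 - (cmod z)\<^sup>2) * cmod (deriv f z)) / (cmod (\<alpha> - f z))\<^sup>2
        \<le> 2 * (D * (1 - (cmod (f z))\<^sup>2)) / (cmod (\<alpha> - f z))\<^sup>2"
      by (intro divide_right_mono mult_left_mono) auto
    then show ?thesis unfolding d cayley_norms(2)[OF \<alpha> lt[OF z]] by (simp add: mult_ac)
  qed
  have "0 \<le> hyp_deriv f 0" using lt2[of 0] by (simp add: hyp_deriv_def)
  then show "0 \<le> D" using D(1)[of 0] by simp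
qed (rule D)

lemma cis_periodic: "cis (t + 2 * pi * of_int k) = cis t"
  by (simp add: cis_mult[symmetric])

lemma AE_radial_limit_neq:
  assumes f: "f holomorphic_on ball 0 1" and lt: "\<And>z. cmod z < 1 \<Longrightarrow> cmod (f z) < 1" and \<alpha>: "cmod \<alpha> = 1"
  shows "AE t in lborel. t \<in> {0..2*pi} \<longrightarrow> \<not> ((\<lambda>r::real. f (of_real r * cis t)) \<longlongrightarrow> \<alpha>) (at_left 1)"
proof -
  \<comment> \<open>\<open>Re h = ln (2 / |1 - f / \<alpha>|)\<close> is nonnegative and tends to infinity wherever \<open>f\<close> tends to \<open>\<alpha>\<close>.\<close>
  define h where "h = (\<lambda>z. of_real (ln 2) - Ln (1 - f z / \<alpha>))"
  have q: "cmod (f z / \<alpha>) < 1" if "cmod z < 1" for z using lt[OF that] \<alpha> by (simp add: norm_divide)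
  have re: "0 < Re (1 - f z / \<alpha>)" if "cmod z < 1" for z
    using q[OF that] complex_Re_le_cmod[of "f z / \<alpha>"] by simp
  have h_hol: "h holomorphic_on ball 0 1"
    unfolding h_def using \<alpha> re
    by (intro holomorphic_intros f) (auto simp: complex_nonpos_Reals_iff dest!: re)
  have Reh: "Re (h z) = ln 2 - ln (cmod (1 - f z / \<alpha>))" if "cmod z < 1" for z
  proof -
    have "1 - f z / \<alpha> \<noteq> 0" using re[OF that] by (metis less_irrefl zero_complex.simps(1))
    then show ?thesis by (simp add: h_def)
  qed
  have pos: "0 \<le> Re (h z)" if "cmod z < 1" for z
  proof -
    have "cmod (1 - f z / \<alpha>) \<le> 2" using q[OF that] norm_triangle_ineq4[of 1 "f z / \<alpha>"] by simp
    moreover have "0 < cmod (1 - f z / \<alpha>)" using re[OF that] by auto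
    ultimately show ?thesis using Reh[OF that] by simp
  qed
  have ev: "\<forall>\<^sub>F r::real in at_left 1. cmod (of_real r * cis t) < 1" for t
    using eventually_at_left_real[of 0 "1::real"] by (auto elim!: eventually_mono simp: norm_mult)
  have "AE t in lborel. t \<in> {0..2*pi} \<longrightarrow> \<not> filterlim (\<lambda>r::real. Re (h (of_real r * cis t))) at_top (at_left 1)"
    by (rule AE_not_radially_infinite[OF h_hol]) (rule pos)
  then show ?thesis
  proof eventually_elim
    case (elim t)
    show ?case
    proof (intro impI notI)
      assume t: "t \<in> {0..2*pi}" and lim: "((\<lambda>r::real. f (of_real r * cis t)) \<longlongrightarrow> \<alpha>) (at_left 1)"
      have "((\<lambda>r::real. cmod (1 - f (of_real r * cis t) / \<alpha>)) \<longlongrightarrow> cmod (1 - \<alpha> / \<alpha>)) (at_left 1)"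
        using \<alpha> by (intro tendsto_intros lim) auto
      moreover have "\<alpha> \<noteq> 0" using \<alpha> by auto
      moreover have "\<forall>\<^sub>F r::real in at_left 1. cmod (1 - f (of_real r * cis t) / \<alpha>) > 0"
        using ev[of t] by eventually_elim (use re in force)
      ultimately have "filterlim (\<lambda>r::real. cmod (1 - f (of_real r * cis t) / \<alpha>)) (at_right 0) (at_left 1)"
        by (auto simp: filterlim_at elim: eventually_mono)
      then have "filterlim (\<lambda>r::real. ln (cmod (1 - f (of_real r * cis t) / \<alpha>))) at_bot (at_left 1)"
        by (rule filterlim_compose[OF ln_at_0])
      then have "filterlim (\<lambda>r::real. ln 2 + - ln (cmod (1 - f (of_real r * cis t) / \<alpha>))) at_top (at_left 1)"
        by (intro filterlim_tendsto_add_at_top[OF tendsto_const]) (simp add: filterlim_uminus_at_bot)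
      moreover have "\<forall>\<^sub>F r::real in at_left 1. ln 2 + - ln (cmod (1 - f (of_real r * cis t) / \<alpha>)) = Re (h (of_real r * cis t))"
        using ev[of t] by eventually_elim (simp add: Reh)
      ultimately have "filterlim (\<lambda>r::real. Re (h (of_real r * cis t))) at_top (at_left 1)"
        by (rule filterlim_cong[THEN iffD1, OF refl refl, rotated])
      then show False using elim t by blast
    qed
  qed
qed

text \<open>For almost every \<open>t\<close> the radial limit \<open>L\<close> is unimodular and,
  by \<open>AE_radial_limit_neq\<close>, differs from \<open>\<alpha>\<close>. In the quotient from
  \<open>cayley_norms\<close> the numerator then tends to 0 and the denominator does not.
  \<open>AE_periodic\<close> extends this from \<open>{0..2*pi}\<close> to the line.\<close>

lemma inner_function_AE_cayley_tendsto_0: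
  assumes inner: "inner_function f" and lt: "\<And>z. cmod z < 1 \<Longrightarrow> cmod (f z) < 1" and \<alpha>: "cmod \<alpha> = 1"
  shows "AE t in lborel. ((\<lambda>r::real. Re ((\<alpha> + f (of_real r * cis t)) / (\<alpha> - f (of_real r * cis t)))) \<longlongrightarrow> 0) (at_left 1)"
proof (rule AE_periodic)
  have f: "f holomorphic_on ball 0 1"
    and L: "AE t in lborel. t \<in> {0..2*pi} \<longrightarrow>
        (\<exists>L. cmod L = 1 \<and> ((\<lambda>r::real. f (of_real r * cis t)) \<longlongrightarrow> L) (at_left 1))"
    using inner by (auto simp: inner_function_def)
  have limit_not: "AE t in lborel. t \<in> {0..2*pi} \<longrightarrow> \<not> ((\<lambda>r::real. f (of_real r * cis t)) \<longlongrightarrow> \<alpha>) (at_left 1)"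
    by (rule AE_radial_limit_neq[OF f _ \<alpha>]) (rule lt)
  show "AE t in lborel. t \<in> {0..2*pi} \<longrightarrow>
      ((\<lambda>r::real. Re ((\<alpha> + f (of_real r * cis t)) / (\<alpha> - f (of_real r * cis t)))) \<longlongrightarrow> 0) (at_left 1)"
    using L limit_not
  proof eventually_elim
    case (elim t)
    show ?case
    proof
      assume "t \<in> {0..2*pi}"
      with elim obtain L where L: "cmod L = 1" "((\<lambda>r::real. f (of_real r * cis t)) \<longlongrightarrow> L) (at_left 1)" "L \<noteq> \<alpha>"
        by metis
      have "((\<lambda>r::real. (1 - (cmod (f (of_real r * cis t)))\<^sup>2) / (cmod (\<alpha> - f (of_real r * cis t)))\<^sup>2)
          \<longlongrightarrow> (1 - (cmod L)\<^sup>2) / (cmod (\<alpha> - L))\<^sup>2) (at_left 1)"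
        using L(3) by (intro tendsto_intros L(2)) auto
      then have "((\<lambda>r::real. (1 - (cmod (f (of_real r * cis t)))\<^sup>2) / (cmod (\<alpha> - f (of_real r * cis t)))\<^sup>2) \<longlongrightarrow> 0) (at_left 1)"
        using L(1) by simp
      moreover have "\<forall>\<^sub>F r::real in at_left 1. (1 - (cmod (f (of_real r * cis t)))\<^sup>2) / (cmod (\<alpha> - f (of_real r * cis t)))\<^sup>2
          = Re ((\<alpha> + f (of_real r * cis t)) / (\<alpha> - f (of_real r * cis t)))"
        using eventually_at_left_real[of 0 "1::real"]
        by (auto elim!: eventually_mono simp: norm_mult cayley_norms(2)[OF \<alpha> lt])
      ultimately show "((\<lambda>r::real. Re ((\<alpha> + f (of_real r * cis t)) / (\<alpha> - f (of_real r * cis t)))) \<longlongrightarrow> 0) (at_left 1)"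
        by (rule Lim_transform_eventually)
    qed
  qed
qed (simp add: cis_periodic)

text \<open>By the third identity of \<open>cayley_norms\<close>, the distance from \<open>f\<close>
  to \<open>\<alpha>\<close> is at most 2 divided by the real part. The contrapositive will be used:
  off the radial preimage the real part has a finite lower limit.\<close>

lemma radial_preimageI:
  assumes lt: "\<And>z. cmod z < 1 \<Longrightarrow> cmod (f z) < 1" and \<alpha>: "cmod \<alpha> = 1"
    and lim: "filterlim (\<lambda>r::real. Re ((\<alpha> + f (of_real r * cis t)) / (\<alpha> - f (of_real r * cis t)))) at_top (at_left 1)"
  shows "cis t \<in> radial_preimage f \<alpha>"
proof -
  let ?u = "\<lambda>r::real. Re ((\<alpha> + f (of_real r * cis t)) / (\<alpha> - f (of_real r * cis t)))"
  have "\<forall>\<^sub>F r::real in at_left 1. 0 < r \<and> r < 1"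
    using eventually_at_left_real[of 0 "1::real"] by (auto elim: eventually_mono)
  moreover have "\<forall>\<^sub>F r in at_left 1. 0 < ?u r" using lim by (simp add: filterlim_at_top_dense)
  ultimately have "\<forall>\<^sub>F r::real in at_left 1. norm (f (of_real r * cis t) - \<alpha>) \<le> 2 / ?u r"
  proof eventually_elim
    case (elim r)
    let ?w = "f (of_real r * cis t)"
    have w: "cmod ?w < 1" using elim by (intro lt) (simp add: norm_mult)
    have p: "0 < cmod (\<alpha> - ?w)" using cayley_norms(1)[OF \<alpha> w] by simp
    have "?u r \<le> 2 / cmod (\<alpha> - ?w)"
      using complex_Re_le_cmod[of "(\<alpha> + ?w) / (\<alpha> - ?w) + 1"] cayley_norms(3)[OF \<alpha> w] by simp
    then show ?case using p elim by (simp add: field_simps norm_minus_commute)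
  qed
  moreover have "((\<lambda>r. 2 / ?u r) \<longlongrightarrow> 0) (at_left 1)"
    by (intro tendsto_divide_0[OF tendsto_const] filterlim_at_top_imp_at_infinity lim)
  ultimately have "((\<lambda>r::real. f (of_real r * cis t) - \<alpha>) \<longlongrightarrow> 0) (at_left 1)"
    by (rule Lim_null_comparison)
  then show ?thesis by (simp add: radial_preimage_def LIM_zero_iff)
qed

section \<open>Content of the radial preimage inside an arc\<close>

theorem theorem4:
  fixes f :: "complex \<Rightarrow> complex"
  assumes "inner_function f"
    and "\<not> (\<exists>c. \<forall>z\<in>ball 0 1. f z = c)"
    and "(SUP z\<in>ball 0 1. hyp_deriv f z) < 1"
  shows "\<forall>\<alpha> a b. cmod \<alpha> = 1 \<longrightarrow> a < b \<longrightarrow>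
           hcontent (1 - (SUP z\<in>ball 0 1. hyp_deriv f z)) (radial_preimage f \<alpha> \<inter> arc a b) > 0"
proof (intro allI impI)
  fix \<alpha> :: complex and a b :: real
  assume \<alpha>: "cmod \<alpha> = 1" and ab: "a < b"
  define D where "D = (SUP z\<in>ball 0 1. hyp_deriv f z)"
  have hol: "f holomorphic_on ball 0 1" using assms(1) by (simp add: inner_function_def)
  note lt = inner_function_norm_less_1[OF assms(1,2)]
  define g where "g = (\<lambda>z. (\<alpha> + f z) / (\<alpha> - f z))"
  interpret slow_growth g D
    unfolding g_def
  proof (rule slow_growth_cayley[OF hol lt \<alpha>])
    show "hyp_deriv f z \<le> D" if "cmod z < 1" for z
      unfolding D_def by (rule hyp_deriv_le_SUP[OF hol lt that])
    show "D < 1" unfolding D_def by (rule assms(3))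
  qed
  \<comment> \<open>The boundary measure was built on intervals of length at most 1, so a long arc
    is replaced by an initial piece; points found there also lie in \<open>arc a b\<close>.\<close>
  define b' where "b' = min b (a + 1)"
  have ab': "a < b'" "b' \<le> a + 1" using ab by (auto simp: b'_def)
  obtain F C where F: "mono F" "continuous_on UNIV F" "F a < F b'" "0 \<le> C"
    "\<And>s t. s \<le> t \<Longrightarrow> F t - F s \<le> C * (t - s) powr (1 - D)"
    and Fu: "\<And>x d. 0 < d \<Longrightarrow> a \<le> x - d \<Longrightarrow> x + d \<le> b' \<Longrightarrow>
        F (x + d) - F (x - d) \<le> 8 * pi * d * Re (g (of_real (1 - d) * cis x))"
    using boundary_distribution[OF ab'] by blast
  define A where "A = {x \<in> {a<..<b'}. cis x \<notin> radial_preimage f \<alpha>}"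
  \<comment> \<open>A radius \<open>r\<close> with \<open>Re g\<close> at most \<open>c\<close>
    yields the symmetric interval of half-length \<open>d = 1 - r\<close>. Since such radii occur
    arbitrarily close to 1, \<open>d\<close> can be taken below any \<open>e\<close>.\<close>
  have local_bound: "\<exists>d>0. d < e \<and> F (x + d) - F (x - d) \<le> 8 * pi * c * d"
    if x: "x \<in> A" and e: "0 < e" and fr: "\<exists>\<^sub>F r::real in at_left 1. Re (g (of_real r * cis x)) \<le> c" for x e c
  proof -
    define e' where "e' = min e (min (x - a) (b' - x))"
    have "0 < e'" using x e by (auto simp: e'_def A_def)
    then have "\<forall>\<^sub>F r in at_left 1. r \<in> {1 - e'<..<1}" by (intro eventually_at_left_real) simp
    then have "\<exists>\<^sub>F r in at_left 1. Re (g (of_real r * cis x)) \<le> c \<and> r \<in> {1 - e'<..<1}"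
      by (intro frequently_rev_mp[OF fr]) (auto elim: eventually_mono)
    then obtain r where r: "Re (g (of_real r * cis x)) \<le> c" "1 - e' < r" "r < 1"
      by (auto dest: frequently_ex)
    define d where "d = 1 - r"
    have d: "0 < d" "d < e" "a \<le> x - d" "x + d \<le> b'" using r by (auto simp: d_def e'_def)
    have "F (x + d) - F (x - d) \<le> 8 * pi * d * Re (g (of_real (1 - d) * cis x))"
      using d by (intro Fu)
    also have "\<dots> \<le> 8 * pi * d * c" using r(1) d by (intro mult_left_mono) (auto simp: d_def)
    finally show ?thesis using d by (auto simp: mult_ac)
  qed
  obtain N where N: "N \<in> null_sets lborel"
    "\<And>t. t \<notin> N \<Longrightarrow> ((\<lambda>r::real. Re (g (of_real r * cis t))) \<longlongrightarrow> 0) (at_left 1)"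
    using AE_E3[OF inner_function_AE_cayley_tendsto_0[OF assms(1) lt \<alpha>]] unfolding g_def by auto
  have "\<exists>B\<in>null_sets (interval_measure F). A \<subseteq> B"
  proof (rule interval_measure_null[OF F(1,2) N(1)])
    show "A \<subseteq> {a<..<b'}" by (auto simp: A_def)
    show "\<exists>d>0. d < e \<and> F (x + d) - F (x - d) \<le> c * d" if "x \<in> A - N" "0 < c" "0 < e" for x c e
    proof -
      have "\<forall>\<^sub>F r::real in at_left 1. Re (g (of_real r * cis x)) < c / (8 * pi)"
        using that by (intro order_tendstoD(2)[OF N(2)]) auto
      then have "\<exists>\<^sub>F r::real in at_left 1. Re (g (of_real r * cis x)) \<le> c / (8 * pi)"
        by (intro eventually_frequently) (auto elim: eventually_mono)
      from local_bound[OF _ that(3) this] that(1) show ?thesis by simp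
    qed
    show "\<exists>n::nat. \<forall>e>0. \<exists>d>0. d < e \<and> F (x + d) - F (x - d) \<le> real n * d" if x: "x \<in> A" for x
    proof -
      \<comment> \<open>On \<open>N\<close> the real part need not tend to 0, but by
        \<open>radial_preimageI\<close> it does not tend to infinity, so it is at most some fixed
        \<open>c\<close> at radii arbitrarily close to 1.\<close>
      have "\<not> filterlim (\<lambda>r::real. Re (g (of_real r * cis x))) at_top (at_left 1)"
        using x radial_preimageI[of f \<alpha> x, OF lt \<alpha>] by (auto simp: A_def g_def)
      then obtain c where c: "\<exists>\<^sub>F r::real in at_left 1. Re (g (of_real r * cis x)) \<le> c"
        by (auto simp: filterlim_at_top_dense not_eventually not_less)
      obtain n :: nat where n: "8 * pi * c \<le> real n" using real_arch_simple by blast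
      have "\<exists>d>0. d < e \<and> F (x + d) - F (x - d) \<le> real n * d" if e: "0 < e" for e
      proof -
        obtain d where d: "0 < d" "d < e" "F (x + d) - F (x - d) \<le> 8 * pi * c * d"
          using local_bound[OF x e c] by blast
        have "8 * pi * c * d \<le> real n * d" using n d(1) by (intro mult_right_mono) auto
        with d(3) have "F (x + d) - F (x - d) \<le> real n * d" by (rule order_trans)
        then show ?thesis using d(1,2) by blast
      qed
      then show ?thesis by blast
    qed
  qed
  then obtain B where B: "B \<in> null_sets (interval_measure F)" "A \<subseteq> B" by blast
  have "cis t \<in> radial_preimage f \<alpha> \<inter> arc a b" if "t \<in> {a<..<b'} - B" for t
    using that B(2) by (auto simp: A_def arc_def b'_def)
  then show "0 < hcontent (1 - (SUP z\<in>ball 0 1. hyp_deriv f z)) (radial_preimage f \<alpha> \<inter> arc a b)"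
    unfolding D_def[symmetric] using D(2)
    by (intro hcontent_pos[OF F(1,2) ab'(2) F(3) _ F(4,5) B(1)]) auto
qed

end
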